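(* Let $d\ge 4$ and let $\{\mathbf S_n\}_{n\ge 0}$ be the simple symmetric random walk on $\mathbb{Z}^d$ started at $\mathbf 0$. For each $\varepsilon>0$, with probability 1 there exists a (random) $n_0=n_0(\varepsilon)$ such that if $n\ge n_0$ then: (i) $(\xi(\mathbf z,n),\xi(\mathbf z+\mathbf e_i,n))\in ((1+\varepsilon)\log n)\,\mathcal B$ for all $\mathbf z\in\mathbb{Z}^d$ and all $i=1,2,\dots,2d$; (ii) for any pair of nonnegative integers $(k,\ell)\in ((1-\varepsilon)\log n)\,\mathcal B$ and for arbitrary $i\in\{1,2,\dots,2d\}$ there exist random $\mathbf z_1,\mathbf z_2\in\mathbb{Z}^d$ for which $$(\xi(\mathbf z_1,n),\xi(\mathbf z_1+\mathbf e_i,n))=(k+1,\ell),\qquad (\xi(\mathbf z_2,n),\xi(\mathbf z_2+\mathbf e_i,n))=(k,\ell+1).$$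
   Context: Simple symmetric random walk on $\mathbb{Z}^d$: $\mathbf S_0=\mathbf 0$, $\mathbf S_n=\sum_{k=1}^n\mathbf X_k$, with $\mathbf X_k$ i.i.d., $\mathbf P(\mathbf X_1=\mathbf e_i)=\frac1{2d}$ for $i=1,\dots,2d$, where $\mathbf e_1,\dots,\mathbf e_d$ are the standard orthogonal unit vectors and $\mathbf e_{d+j}=-\mathbf e_j$, $j=1,\dots,d$. Local time: $\xi(\mathbf z,n)=\#\{k: 0<k\le n,\ \mathbf S_k=\mathbf z\}$ (time $0$ is not counted). $\gamma=\gamma(d)>0$ is the probability that the walk never returns to its starting point, and $\alpha=\frac{1-\gamma}{2-\gamma}$. $\mathcal B=\{(x,y)\in\mathbb{R}^2: x\ge0,\ y\ge 0,\ -(x+y)\log(x+y)+x\log x+y\log y-(x+y)\log\alpha\le 1\}$, with the convention $0\log 0=0$. For real $c$, $c\,\mathcal B=\{(cx,cy):(x,y)\in\mathcal B\}$. *)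

theory Defs
  imports "HOL-Probability.Probability"
begin

text \<open>The lattice is \<open>int ^ 'd\<close>, with dimension \<open>CARD('d)\<close>. The set
  \<open>unit_steps\<close> consists of the \<open>2 * CARD('d)\<close> vectors \<open>e_1, ..., e_2d\<close>.\<close>

definition unit_steps :: "(int ^ 'd) set" where
  "unit_steps = range (\<lambda>j. axis j 1) \<union> range (\<lambda>j. - axis j 1)"

lemma card_unit_steps: "card (unit_steps :: (int ^ 'd) set) = 2 * CARD('d)"
proof -
  have inj: "inj (\<lambda>j::'d. axis j (1::int))" "inj (\<lambda>j::'d. - axis j (1::int))"
    by (auto simp: inj_on_def axis_eq_axis)
  have neq: "axis i (1::int) \<noteq> - axis j 1" for i j :: 'd
  proof
    assume "axis i (1::int) = - axis j 1"
    then have "axis i (1::int) $ i = (- axis j 1) $ i" by (rule arg_cong)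
    then show False by (simp add: axis_def split: if_splits)
  qed
  have "range (\<lambda>j::'d. axis j (1::int)) \<inter> range (\<lambda>j. - axis j 1) = {}"
    using neq by auto
  then show ?thesis
    unfolding unit_steps_def by (simp add: card_Un_disjoint card_image inj)
qed

text \<open>The steps are \<open>X 1, X 2, ...\<close>; the value \<open>X 0\<close> plays no role.\<close>

locale simple_random_walk = prob_space M
  for M :: "'a measure" and X :: "nat \<Rightarrow> 'a \<Rightarrow> int ^ 'd" +
  assumes indep_steps: "indep_vars (\<lambda>_. count_space UNIV) X {1..}"
    and step_prob: "\<And>k e. 1 \<le> k \<Longrightarrow> e \<in> unit_steps \<Longrightarrow>
      prob {\<omega> \<in> space M. X k \<omega> = e} = 1 / (2 * real CARD('d))"

definition walk :: "(nat \<Rightarrow> 'a \<Rightarrow> int ^ 'd) \<Rightarrow> nat \<Rightarrow> 'a \<Rightarrow> int ^ 'd" where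
  "walk X n \<omega> = (\<Sum>k=1..n. X k \<omega>)"

definition local_time :: "(nat \<Rightarrow> 'a \<Rightarrow> int ^ 'd) \<Rightarrow> 'a \<Rightarrow> int ^ 'd \<Rightarrow> nat \<Rightarrow> nat" where
  "local_time X \<omega> z n = card {k. 0 < k \<and> k \<le> n \<and> walk X k \<omega> = z}"

definition escape_prob :: "'a measure \<Rightarrow> (nat \<Rightarrow> 'a \<Rightarrow> int ^ 'd) \<Rightarrow> real" where
  "escape_prob M X = measure M {\<omega> \<in> space M. \<forall>n\<ge>1. walk X n \<omega> \<noteq> 0}"

definition walk_alpha :: "'a measure \<Rightarrow> (nat \<Rightarrow> 'a \<Rightarrow> int ^ 'd) \<Rightarrow> real" where
  "walk_alpha M X = (1 - escape_prob M X) / (2 - escape_prob M X)"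

text \<open>The convention \<open>0 * ln 0 = 0\<close> holds automatically.\<close>

definition region_B :: "real \<Rightarrow> (real \<times> real) set" where
  "region_B \<alpha> = {(x, y). 0 \<le> x \<and> 0 \<le> y \<and>
     - (x + y) * ln (x + y) + x * ln x + y * ln y - (x + y) * ln \<alpha> \<le> 1}"

end

theory Submission
  imports Defs "HOL-Real_Asymp.Real_Asymp"
begin

text \<open>
  Seen from one of two neighbouring sites, the next visit to the pair is to either site with the
  same probability \<open>\<alpha>\<close>, so the pair is visited \<open>(k, l)\<close> times with probability
  \<open>(k + l choose k) \<alpha>\<^sup>k\<^sup>+\<^sup>l (1 - 2 \<alpha>)\<close>. This is \<open>exp (- F(k, l))\<close> up to polynomial factors, where
  \<open>F\<close> is the function, homogeneous of degree one, whose sublevel set at level 1 is \<open>\<B>\<close>.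

  Part (i) is a union bound over the first visit to the pair, along \<open>n = 2\<^sup>m\<close>.
  For part (ii) a time \<open>j\<close> is good for \<open>(k, l)\<close> if the pair at the position at time \<open>j\<close> was not visited
  shortly before \<open>j\<close>, is visited \<open>(k, l)\<close> times shortly after \<open>j\<close>, and then not for a while. Good times
  in disjoint blocks are independent. With \<open>K\<close> blocks, where \<open>K\<close> times the probability of a good
  time is of order \<open>log n\<close>, the two ways to fail are both unlikely: no block is good, or the pair of
  some good block is also visited outside that block.

  Transience and the polynomial decay of late returns both come from the space-time superharmonic function
  \<open>(64 + |a|\<^sup>2 + T / 8) powr (- 1 / 2)\<close>, which is available because the dimension is at least 4.
\<close>

section \<open>A superharmonic function for the walk\<close>

lemma finite_unit_steps [simp]: "finite (unit_steps :: (int ^ 'd) set)"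
  by (simp add: unit_steps_def)

lemma uminus_unit_steps [simp]: "- e \<in> unit_steps \<longleftrightarrow> e \<in> (unit_steps :: (int ^ 'd) set)"
proof -
  have "- e \<in> unit_steps" if "e \<in> unit_steps" for e :: "int ^ 'd"
    using that by (auto simp: unit_steps_def)
  from this[of e] this[of "- e"] show ?thesis by auto
qed

lemma zero_notin_unit_steps [simp]: "0 \<notin> (unit_steps :: (int ^ 'd) set)"
  by (auto simp: unit_steps_def axis_eq_0_iff)

definition step_mean :: "((int ^ 'd) \<Rightarrow> real) \<Rightarrow> real" where
  "step_mean f = (\<Sum>e\<in>unit_steps. f e) / (2 * real CARD('d))"

lemma step_mean_axis:
  "step_mean f = (\<Sum>j\<in>UNIV. f (axis j 1) + f (- axis j (1::int))) / (2 * real CARD('d))"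
  for f :: "int ^ 'd \<Rightarrow> real"
proof -
  have inj: "inj (\<lambda>j::'d. axis j (1::int))" "inj (\<lambda>j::'d. - axis j (1::int))"
    by (auto simp: inj_on_def axis_eq_axis)
  have neq: "axis i (1::int) \<noteq> - axis j 1" for i j :: 'd
  proof
    assume "axis i (1::int) = - axis j 1"
    then have "axis i (1::int) $ i = (- axis j 1) $ i" by (rule arg_cong)
    then show False by (simp add: axis_def split: if_splits)
  qed
  have "(\<Sum>e\<in>unit_steps. f e) = (\<Sum>e\<in>range (\<lambda>j. axis j 1). f e) + (\<Sum>e\<in>range (\<lambda>j. - axis j 1). f e)"
    unfolding unit_steps_def using neq by (intro sum.union_disjoint) auto
  then show ?thesis
    by (simp add: step_mean_def sum.reindex inj sum.distrib)
qed

lemma step_mean_const [simp]: "step_mean (\<lambda>_::int ^ 'd. c) = c"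
  by (simp add: step_mean_def card_unit_steps)

lemma step_mean_add: "step_mean (\<lambda>x. f x + g x) = step_mean f + step_mean g"
  by (simp add: step_mean_def sum.distrib add_divide_distrib)

lemma step_mean_cmult: "step_mean (\<lambda>x. c * f x) = c * step_mean f"
  by (simp add: step_mean_def sum_distrib_left)

lemma step_mean_mono:
  "(\<And>x. x \<in> unit_steps \<Longrightarrow> f x \<le> g x) \<Longrightarrow> step_mean f \<le> step_mean g"
  unfolding step_mean_def by (intro divide_right_mono sum_mono) auto

lemma step_mean_cong:
  "(\<And>x. x \<in> unit_steps \<Longrightarrow> f x = g x) \<Longrightarrow> step_mean f = step_mean g"
  unfolding step_mean_def by (intro arg_cong2[of _ _ _ _ "(/)"] sum.cong) auto

lemma step_mean_bij:
  fixes \<phi> :: "int ^ 'd \<Rightarrow> int ^ 'd"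
  shows "bij_betw \<phi> unit_steps unit_steps \<Longrightarrow> step_mean (\<lambda>x. f (\<phi> x)) = step_mean f"
  unfolding step_mean_def by (simp add: sum.reindex_bij_betw)

section \<open>The space-time potential and its superharmonicity\<close>

definition sqnorm :: "int ^ 'd \<Rightarrow> real" where
  "sqnorm a = (\<Sum>i\<in>UNIV. (real_of_int (a $ i))\<^sup>2)"

text \<open>\<open>T\<close> is the number of steps that must pass before a visit to
  \<open>a\<close> counts. The factor 8 normalizes the value at \<open>T = 0\<close>,
  \<open>a = 0\<close> to 1, the shift 64 keeps the relative change in one step small, and the rate
  1/8 of time is matched to dimension 4 in \<open>step_mean_potential\<close>.\<close>

definition potential :: "nat \<Rightarrow> int ^ 'd \<Rightarrow> real" where
  "potential T a = 8 / sqrt (64 + sqnorm a + real T / 8)"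

lemma sqnorm_nonneg: "0 \<le> sqnorm a"
  by (simp add: sqnorm_def sum_nonneg)

lemma sqnorm_minus_axis: "sqnorm (a - axis j 1) = sqnorm a + 1 - 2 * real_of_int (a $ j)"
  and sqnorm_plus_axis: "sqnorm (a + axis j 1) = sqnorm a + 1 + 2 * real_of_int (a $ j)"
proof -
  have "sqnorm (a - axis j 1) = (\<Sum>i\<in>UNIV. (real_of_int (a $ i))\<^sup>2 + (if i = j then 1 - 2 * real_of_int (a $ j) else 0))"
    unfolding sqnorm_def by (intro sum.cong) (auto simp: axis_def power2_eq_square algebra_simps)
  then show "sqnorm (a - axis j 1) = sqnorm a + 1 - 2 * real_of_int (a $ j)"
    by (simp add: sum.distrib sqnorm_def)
  have "sqnorm (a + axis j 1) = (\<Sum>i\<in>UNIV. (real_of_int (a $ i))\<^sup>2 + (if i = j then 1 + 2 * real_of_int (a $ j) else 0))"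
    unfolding sqnorm_def by (intro sum.cong) (auto simp: axis_def power2_eq_square algebra_simps)
  then show "sqnorm (a + axis j 1) = sqnorm a + 1 + 2 * real_of_int (a $ j)"
    by (simp add: sum.distrib sqnorm_def)
qed

text \<open>The right side is the Taylor polynomial of degree 3 with the quadratic coefficient
  raised from 3/8 to 7/16, which absorbs the remainder in this range of \<open>v\<close>.\<close>

lemma inverse_sqrt_taylor:
  fixes v :: real
  assumes "\<bar>v\<bar> \<le> 1 / 4"
  shows "1 / sqrt (1 + v) \<le> 1 - v / 2 + 7 / 16 * v\<^sup>2 - 5 / 16 * v ^ 3"
proof -
  let ?P = "1 - v / 2 + 7 / 16 * v\<^sup>2 - 5 / 16 * v ^ 3"
  have v2: "v\<^sup>2 \<le> 1 / 16"
    using power_mono[OF assms, of 2] by (simp add: power_divide)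
  have v3: "\<bar>v ^ 3\<bar> \<le> 1 / 64"
    using power_mono[OF assms, of 3] by (simp add: power_divide power_abs)
  have pos: "?P > 0" using v3 assms zero_le_power2[of v] by linarith
  have v4: "v ^ 4 \<le> 1 / 256" "\<bar>v ^ 5\<bar> \<le> 1 / 1024"
    using power_mono[OF assms, of 4] power_mono[OF assms, of 5] by (simp_all add: power_divide power_abs)
  \<comment> \<open>\<open>?Q\<close> is the cofactor of v^2 in
    \<open>?P\<^sup>2 * (1 + v) - 1\<close>; its constant term 1/8 dominates the other
    terms.\<close>
  let ?Q = "1/8 + v/16 - 143/256* v\<^sup>2 + 59/256* v^3 - 45/256* v^4 + 25/256* v^5"
  have "0 \<le> ?Q" using v2 v3 v4 assms by (auto simp: abs_le_iff)
  then have "0 \<le> v\<^sup>2 * ?Q" by simp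
  moreover have "?P\<^sup>2 * (1 + v) - 1 = v\<^sup>2 * ?Q"
    by (simp add: eval_nat_numeral field_simps)
  ultimately have ge: "1 \<le> ?P\<^sup>2 * (1 + v)" by linarith
  have "1 = sqrt 1" by simp
  also have "\<dots> \<le> sqrt (?P\<^sup>2 * (1 + v))" using ge by (intro real_sqrt_le_mono)
  also have "\<dots> = ?P * sqrt (1 + v)" using pos by (simp add: real_sqrt_mult)
  finally show ?thesis using pos_divide_le_eq[of "sqrt (1 + v)" 1 ?P] assms by (simp add: abs_le_iff)
qed

text \<open>The odd Taylor terms in u / R cancel. The hypotheses give (u / R)^2 <= 4 / R <= 1 / 16,
  which is the range of \<open>inverse_sqrt_taylor\<close>.\<close>

lemma inverse_sqrt_symmetric_sum:
  fixes R u :: real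
  assumes R: "64 \<le> R" and u: "u\<^sup>2 \<le> 4 * R"
  shows "1 / sqrt (R + u) + 1 / sqrt (R - u) \<le> (2 + 7 / 8 * (u / R)\<^sup>2) / sqrt R"
proof -
  let ?v = "u / R"
  have "?v\<^sup>2 \<le> 4 / R" using R u by (simp add: power_divide power2_eq_square field_simps)
  also have "\<dots> \<le> (1/4)\<^sup>2" using R by (simp add: power2_eq_square field_simps)
  finally have v: "\<bar>?v\<bar> \<le> 1 / 4" by (simp add: power2_le_iff_abs_le)
  have "R + u = R * (1 + ?v)" "R - u = R * (1 + - ?v)" using R by (simp_all add: field_simps)
  then have "1 / sqrt (R + u) + 1 / sqrt (R - u) = (1 / sqrt (1 + ?v) + 1 / sqrt (1 + - ?v)) / sqrt R"
    by (simp only: real_sqrt_mult) (simp add: add_divide_distrib mult.commute)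
  also have "\<dots> \<le> (2 + 7 / 8 * ?v\<^sup>2) / sqrt R"
    using inverse_sqrt_taylor[of ?v] inverse_sqrt_taylor[of "- ?v"] v R
    by (intro divide_right_mono) auto
  finally show ?thesis .
qed

text \<open>Opposite steps are paired, so only second-order terms survive; they raise the average by
  a relative amount of at most 7 / (4 d R), hence 7 / (16 R) for d >= 4. On the other side the
  squared norm grows by 1 per step on average while time contributes only 1/8, so the target has R -
  7/8 under the root. To first order both corrections equal 7 / (16 R).\<close>

lemma step_mean_potential:
  fixes a :: "int ^ 'd"
  assumes "4 \<le> CARD('d)"
  shows "step_mean (\<lambda>x. potential T (a - x)) \<le> potential (Suc T) a"
proof -
  \<comment> \<open>\<open>R\<close> is the quantity under the root after one step, without the term
    linear in \<open>a $ j\<close>; hence 65 = 64 + 1.\<close>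
  define R where "R = 65 + sqnorm a + real T / 8"
  have R: "64 \<le> R" "sqnorm a \<le> R" using sqnorm_nonneg[of a] by (auto simp: R_def)
  let ?d = "real CARD('d)"
  have d: "4 \<le> ?d" using assms by simp
  have term_le: "potential T (a - axis j 1) + potential T (a - - axis j 1)
      \<le> 8 / sqrt R * (2 + 7 / 2 * (real_of_int (a $ j))\<^sup>2 / R\<^sup>2)" for j
  proof -
    let ?u = "2 * real_of_int (a $ j)"
    have "(real_of_int (a $ j))\<^sup>2 \<le> sqnorm a"
      unfolding sqnorm_def by (rule member_le_sum) auto
    then have "?u\<^sup>2 \<le> 4 * R" using R by (simp add: power2_eq_square)
    from inverse_sqrt_symmetric_sum[OF R(1) this]
    have "1 / sqrt (R + ?u) + 1 / sqrt (R - ?u) \<le> (2 + 7 / 2 * (real_of_int (a $ j))\<^sup>2 / R\<^sup>2) / sqrt R"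
      by (simp add: power_divide power_mult_distrib)
    moreover have "potential T (a - axis j 1) = 8 * (1 / sqrt (R - ?u))"
      "potential T (a - - axis j 1) = 8 * (1 / sqrt (R + ?u))"
      by (simp_all add: potential_def sqnorm_minus_axis sqnorm_plus_axis R_def algebra_simps)
    ultimately show ?thesis
      by (simp only: distrib_left[symmetric]) (metis (no_types) add.commute mult_left_mono times_divide_eq_left times_divide_eq_right zero_le_numeral)
  qed
  have "step_mean (\<lambda>x. potential T (a - x))
      \<le> (\<Sum>j\<in>(UNIV::'d set). 8 / sqrt R * (2 + 7 / 2 * (real_of_int (a $ j))\<^sup>2 / R\<^sup>2)) / (2 * ?d)"
    unfolding step_mean_axis using term_le by (intro divide_right_mono sum_mono) auto
  also have "\<dots> = 8 / sqrt R * (2 * ?d + 7 / 2 * sqnorm a / R\<^sup>2) / (2 * ?d)"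
    by (simp only: sum_distrib_left[symmetric] sum.distrib sum_divide_distrib[symmetric] sqnorm_def) simp
  also have "\<dots> = 8 / sqrt R * (1 + 7 / 4 * sqnorm a / (?d * R\<^sup>2))"
    using R d by (simp add: field_simps)
  also have "\<dots> \<le> 8 / sqrt R * (1 + 7 / 16 / R)"
  proof -
    have "28 * (sqnorm a * R) \<le> (7 * ?d) * (R * R)"
      using d R sqnorm_nonneg[of a] by (intro mult_mono) (auto intro: mult_mono)
    then show ?thesis using R d by (intro mult_left_mono) (auto simp: field_simps power2_eq_square)
  qed
  also have "\<dots> \<le> 8 / sqrt (R - 7 / 8)"
  proof -
    \<comment> \<open>With this \<open>t\<close> the radicand R - 7/8 is R (1 - 2 t), and (1 + t)^2
      (1 - 2 t) <= 1 because the linear terms cancel.\<close>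
    define t where "t = 7 / 16 / R"
    have t: "0 \<le> t" using R by (simp add: t_def)
    have "(1 + t)\<^sup>2 * (R - 7 / 8) = R * ((1 + t)\<^sup>2 * (1 - 2 * t))"
      using R by (simp add: t_def field_simps)
    also have "(1 + t)\<^sup>2 * (1 - 2 * t) = 1 - 3 * t\<^sup>2 - 2 * t ^ 3"
      by (simp add: power2_eq_square power3_eq_cube algebra_simps)
    also have "R * \<dots> \<le> R * 1"
      using R zero_le_power2[of t] zero_le_power[OF t, of 3] by (intro mult_left_mono) linarith+
    finally have "sqrt ((1 + t)\<^sup>2 * (R - 7 / 8)) \<le> sqrt R" by (intro real_sqrt_le_mono) simp
    then have "(1 + t) * sqrt (R - 7 / 8) \<le> sqrt R" using t by (simp add: real_sqrt_mult)
    then show ?thesis using R unfolding t_def[symmetric] by (simp add: field_simps)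
  qed
  also have "\<dots> = potential (Suc T) a"
    by (simp add: potential_def R_def algebra_simps add_divide_distrib)
  finally show ?thesis .
qed

lemma potential_nonneg: "0 \<le> potential T a"
  using sqnorm_nonneg[of a] by (simp add: potential_def)

lemma potential_0_0: "potential 0 0 = 1"
  by (simp add: potential_def sqnorm_def)

lemma potential_antimono: "S \<le> T \<Longrightarrow> potential T a \<le> potential S a"
  using sqnorm_nonneg[of a] unfolding potential_def
  by (intro divide_left_mono mult_pos_pos) (auto intro!: real_sqrt_gt_zero add_pos_nonneg)

text \<open>The strict inequality is what makes the return probability smaller than 1 in
  \<open>return_lim_less_1\<close>.\<close>

lemma potential_1_less_1: "potential (Suc 0) a < 1"
  using sqnorm_nonneg[of a] real_less_rsqrt[of 8 "64 + sqnorm a + 1/8"]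
  by (simp add: potential_def)

text \<open>The constant comes from 8 * sqrt 8 < 23.\<close>

lemma potential_le: "0 < T \<Longrightarrow> potential T a \<le> 23 / sqrt (real T)"
proof -
  assume T: "0 < T"
  have "sqrt (real T) / (23/8) = sqrt (real T / (23/8)\<^sup>2)"
    by (simp add: real_sqrt_divide)
  also have "\<dots> \<le> sqrt (64 + sqnorm a + real T / 8)"
    using sqnorm_nonneg[of a] by (intro real_sqrt_le_mono) (simp add: power2_eq_square)
  finally show ?thesis using T sqnorm_nonneg[of a]
    by (simp add: potential_def field_simps add_pos_nonneg)
qed

section \<open>Averages over step sequences and hitting probabilities\<close>

text \<open>Probabilities are taken over step lists, so that no measurability questions arise and
  conditioning on the first step is the defining equation. \<open>prob_steps_upto\<close> transfers
  them to the walk.\<close>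

primrec path_prob :: "nat \<Rightarrow> ((int ^ 'd) list \<Rightarrow> bool) \<Rightarrow> real" where
  "path_prob 0 P = of_bool (P [])"
| "path_prob (Suc n) P = step_mean (\<lambda>x. path_prob n (\<lambda>xs. P (x # xs)))"

lemma path_prob_mono:
  "(\<And>xs. length xs = n \<Longrightarrow> P xs \<Longrightarrow> Q xs) \<Longrightarrow> path_prob n P \<le> path_prob n Q"
  by (induction n arbitrary: P Q) (auto intro!: step_mean_mono)

lemma path_prob_cong:
  "(\<And>xs. length xs = n \<Longrightarrow> P xs \<longleftrightarrow> Q xs) \<Longrightarrow> path_prob n P = path_prob n Q"
  by (intro antisym path_prob_mono) auto

lemma path_prob_const [simp]: "path_prob n (\<lambda>_. P) = of_bool P"
  by (induction n) auto

lemma path_prob_nonneg: "0 \<le> path_prob n P"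
  using path_prob_mono[of n "\<lambda>_. False" P] by simp

lemma path_prob_le_1: "path_prob n P \<le> 1"
  using path_prob_mono[of n P "\<lambda>_. True"] by simp

lemma path_prob_disj_disjoint:
  "(\<And>xs. length xs = n \<Longrightarrow> \<not> (P xs \<and> Q xs)) \<Longrightarrow>
    path_prob n (\<lambda>xs. P xs \<or> Q xs) = path_prob n P + path_prob n Q"
  by (induction n arbitrary: P Q) (auto simp: step_mean_add[symmetric] intro!: step_mean_cong)

lemma path_prob_not: "path_prob n (\<lambda>xs. \<not> P xs) = 1 - path_prob n P"
  using path_prob_disj_disjoint[of n P "\<lambda>xs. \<not> P xs"] by simp

lemma path_prob_disj: "path_prob n (\<lambda>xs. P xs \<or> Q xs) \<le> path_prob n P + path_prob n Q"
proof -
  have "path_prob n (\<lambda>xs. P xs \<or> Q xs) = path_prob n (\<lambda>xs. P xs \<or> (Q xs \<and> \<not> P xs))"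
    by (rule path_prob_cong) auto
  also have "\<dots> = path_prob n P + path_prob n (\<lambda>xs. Q xs \<and> \<not> P xs)"
    by (rule path_prob_disj_disjoint) auto
  also have "\<dots> \<le> path_prob n P + path_prob n Q"
    by (intro add_left_mono path_prob_mono) auto
  finally show ?thesis .
qed

lemma path_prob_Bex:
  "finite I \<Longrightarrow> path_prob n (\<lambda>xs. \<exists>i\<in>I. P i xs) \<le> (\<Sum>i\<in>I. path_prob n (P i))"
proof (induction I rule: finite_induct)
  case (insert i I)
  then show ?case using path_prob_disj[of n "P i" "\<lambda>xs. \<exists>i\<in>I. P i xs"] by simp
qed simp

text \<open>This is conditioning on the first \<open>m\<close> steps: \<open>Q\<close> depends on
  these alone, and \<open>c\<close> bounds the conditional probability of \<open>P\<close> uniformly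
  on \<open>Q\<close>.\<close>

lemma path_prob_append_le:
  assumes "\<And>xs. length xs = m \<Longrightarrow> Q xs \<Longrightarrow> path_prob n (\<lambda>ys. P (xs @ ys)) \<le> c"
  shows "path_prob (m + n) (\<lambda>xs. Q (take m xs) \<and> P xs) \<le> path_prob m Q * c"
  using assms
proof (induction m arbitrary: Q P)
  case (Suc m)
  have "path_prob (m + n) (\<lambda>xs. Q (x # take m xs) \<and> P (x # xs)) \<le> path_prob m (\<lambda>xs. Q (x # xs)) * c" for x
    by (rule Suc.IH) (use Suc.prems[of "x # _"] in auto)
  then show ?case
    by (auto simp: mult.commute[of _ c] step_mean_cmult[symmetric] intro!: step_mean_mono)
qed (auto simp: of_bool_def)

lemma path_prob_take_drop:
  "path_prob (m + n) (\<lambda>xs. Q (take m xs) \<and> P (drop m xs)) = path_prob m Q * path_prob n P"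
proof (induction m arbitrary: Q)
  case (Suc m)
  then show ?case
    by (auto simp: mult.commute[of _ "path_prob n P"] step_mean_cmult[symmetric] intro!: step_mean_cong)
qed (auto simp: of_bool_def)

lemma path_prob_take: "path_prob (m + n) (\<lambda>xs. Q (take m xs)) = path_prob m Q"
  using path_prob_take_drop[of m n Q "\<lambda>_. True"] by simp

lemma path_prob_drop: "path_prob (m + n) (\<lambda>xs. P (drop m xs)) = path_prob n P"
  using path_prob_take_drop[of m n "\<lambda>_. True" P] by simp

text \<open>All lists of unit steps of a given length are equally likely. This turns time reversal
  into a bijection of a finite set and lets \<open>prob_steps_upto\<close> sum over single
  lists.\<close>

lemma path_prob_eq_card:
  "path_prob n (P :: (int ^ 'd) list \<Rightarrow> bool) =
    card {xs. set xs \<subseteq> unit_steps \<and> length xs = n \<and> P xs} / (2 * real CARD('d)) ^ n"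
proof (induction n arbitrary: P)
  case 0
  have "{xs. set xs \<subseteq> unit_steps \<and> length xs = 0 \<and> P xs} = (if P [] then {[]} else {})" by auto
  then show ?case by (auto simp: of_bool_def)
next
  case (Suc n)
  have fin: "finite {xs. set xs \<subseteq> unit_steps \<and> length xs = n \<and> Q xs}" for Q :: "(int ^ 'd) list \<Rightarrow> bool"
    by (rule finite_subset[OF _ finite_lists_length_eq[OF finite_unit_steps, of n]]) auto
  have "{xs. set xs \<subseteq> unit_steps \<and> length xs = Suc n \<and> P xs} =
      (\<lambda>(x, xs). x # xs) ` (SIGMA x:unit_steps. {xs. set xs \<subseteq> unit_steps \<and> length xs = n \<and> P (x # xs)})"
    by (auto simp: length_Suc_conv image_iff)
  also have "card \<dots> = (\<Sum>x\<in>unit_steps. card {xs. set xs \<subseteq> unit_steps \<and> length xs = n \<and> P (x # xs)})"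
    using fin by (subst card_image) (auto simp: inj_on_def)
  finally show ?case
    by (simp add: Suc.IH step_mean_def sum_divide_distrib[symmetric] mult.commute)
qed

lemma path_prob_rev: "path_prob n (\<lambda>xs. P (rev xs)) = path_prob n P"
proof -
  have "bij_betw rev {xs. set xs \<subseteq> unit_steps \<and> length xs = n \<and> P (rev xs)}
      {xs. set xs \<subseteq> unit_steps \<and> length xs = n \<and> P xs}"
    by (rule bij_betw_byWitness[where f' = rev]) auto
  then show ?thesis by (simp add: path_prob_eq_card bij_betw_same_card)
qed

lemma path_prob_map:
  fixes P :: "(int ^ 'd) list \<Rightarrow> bool"
  assumes "bij_betw \<phi> (unit_steps :: (int ^ 'd) set) unit_steps"
  shows "path_prob n (\<lambda>xs. P (map \<phi> xs)) = path_prob n P"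
proof (induction n arbitrary: P)
  case (Suc n)
  then show ?case
    using step_mean_bij[OF assms, of "\<lambda>x. path_prob n (\<lambda>xs. P (x # xs))"]
    by (simp add: Suc.IH[of "\<lambda>xs. P (_ # xs)"])
qed simp

text \<open>Only nonempty prefixes are counted: time 0 is excluded.\<close>

primrec visits :: "int ^ 'd \<Rightarrow> (int ^ 'd) list \<Rightarrow> nat" where
  "visits z [] = 0"
| "visits z (x # xs) = of_bool (x = z) + visits (z - x) xs"

lemma visits_append: "visits z (xs @ ys) = visits z xs + visits (z - sum_list xs) ys"
  by (induction xs arbitrary: z) (auto simp: algebra_simps)

lemma visits_take_le: "visits z (take i xs) \<le> visits z xs"
  using visits_append[of z "take i xs" "drop i xs"] by simp

lemma visits_le_length: "visits z xs \<le> length xs"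
proof (induction xs arbitrary: z)
  case (Cons x xs)
  from Cons.IH[of "z - x"] Cons.IH[of 0] show ?case by (auto simp: of_bool_def)
qed simp

lemma visits_map:
  "(\<And>x y. \<phi> (x - y) = \<phi> x - \<phi> y) \<Longrightarrow> inj \<phi> \<Longrightarrow> visits (\<phi> z) (map \<phi> xs) = visits z xs"
proof (induction xs arbitrary: z)
  case (Cons x xs)
  from Cons.IH[of "z - x"] Cons.prems show ?case by (simp add: inj_eq)
qed simp

text \<open>The targets are translated by \<open>- x\<close> instead of moving the walk, so each
  recursive call starts at the origin again.\<close>

primrec first_at :: "int ^ 'd \<Rightarrow> int ^ 'd \<Rightarrow> (int ^ 'd) list \<Rightarrow> bool" where
  "first_at a b [] = False"
| "first_at a b (x # xs) = (x = a \<or> x \<noteq> b \<and> first_at (a - x) (b - x) xs)"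

lemma visits_pair_eq_0_iff:
  "visits a xs = 0 \<and> visits b xs = 0 \<longleftrightarrow> \<not> (first_at a b xs \<or> first_at b a xs)"
  by (induction xs arbitrary: a b) auto

lemma first_at_exclusive: "a \<noteq> b \<Longrightarrow> \<not> (first_at a b xs \<and> first_at b a xs)"
proof (induction xs arbitrary: a b)
  case (Cons x xs)
  from Cons.IH[of "a - x" "b - x"] Cons.prems show ?case by auto
qed simp

section \<open>Reaching a site, and hitting one site before another\<close>

definition reach :: "nat \<Rightarrow> int ^ 'd \<Rightarrow> real" where
  "reach n a = path_prob n (\<lambda>xs. visits a xs \<noteq> 0)"

definition hit :: "nat \<Rightarrow> int ^ 'd \<Rightarrow> int ^ 'd \<Rightarrow> real" where
  "hit n a b = path_prob n (first_at a b)"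

lemma reach_0 [simp]: "reach 0 a = 0"
  and reach_Suc: "reach (Suc n) a = step_mean (\<lambda>x. if x = a then 1 else reach n (a - x))"
  by (auto simp: reach_def intro!: step_mean_cong)

lemma hit_0 [simp]: "hit 0 a b = 0"
  and hit_Suc: "hit (Suc n) a b =
    step_mean (\<lambda>x. if x = a then 1 else if x = b then 0 else hit n (a - x) (b - x))"
  by (auto simp: hit_def intro!: step_mean_cong)

lemma reach_nonneg: "0 \<le> reach n a" and reach_le_1: "reach n a \<le> 1"
  by (simp_all add: reach_def path_prob_nonneg path_prob_le_1)

lemma hit_nonneg: "0 \<le> hit n a b" and hit_le_1: "hit n a b \<le> 1"
  by (simp_all add: hit_def path_prob_nonneg path_prob_le_1)

lemma path_prob_no_visit:
  "a \<noteq> b \<Longrightarrow> path_prob n (\<lambda>xs. visits a xs = 0 \<and> visits b xs = 0) = 1 - hit n a b - hit n b a"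
  by (simp only: visits_pair_eq_0_iff path_prob_not)
    (simp add: path_prob_disj_disjoint first_at_exclusive hit_def)

lemma unit_steps_transitive:
  fixes e e' :: "int ^ 'd"
  assumes "e \<in> unit_steps" "e' \<in> unit_steps"
  obtains \<phi> :: "int ^ 'd \<Rightarrow> int ^ 'd" where
    "\<phi> e = e'" "\<And>x y. \<phi> (x - y) = \<phi> x - \<phi> y" "inj \<phi>" "bij_betw \<phi> unit_steps unit_steps"
proof -
  obtain s j where e: "e = s *s axis j 1" and s: "s = 1 \<or> s = -1"
    using assms(1) unfolding unit_steps_def by (auto; metis vector_smult_lid vector_sneg_minus1)
  obtain s' j' where e': "e' = s' *s axis j' 1" and s': "s' = 1 \<or> s' = -1"
    using assms(2) unfolding unit_steps_def by (auto; metis vector_smult_lid vector_sneg_minus1)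
  \<comment> \<open>The map transposes the two axes and multiplies every coordinate by the product
    of the two signs. It is an involution, hence its own inverse.\<close>
  define \<phi> :: "int ^ 'd \<Rightarrow> int ^ 'd" where
    "\<phi> v = (\<chi> i. (s * s') * v $ (Transposition.transpose j j' i))" for v
  have ss: "s * s' * (s * s') = 1" "s' * s * s = s'" using s s' by auto
  have inv: "\<phi> (\<phi> v) = v" for v
    using ss(1) by (simp add: \<phi>_def vec_eq_iff mult.assoc[symmetric])
  have ax: "\<phi> (axis i 1) = (s * s') *s axis (Transposition.transpose j j' i) 1" for i
    by (auto simp: \<phi>_def vec_eq_iff axis_def Transposition.transpose_def)
  have diff: "\<phi> (x - y) = \<phi> x - \<phi> y" for x y
    by (simp add: \<phi>_def vec_eq_iff algebra_simps)
  have "\<phi> x \<in> unit_steps" if "x \<in> unit_steps" for x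
  proof -
    have "\<phi> (axis i 1) \<in> unit_steps" for i
      using s s' by (auto simp: ax unit_steps_def vector_sneg_minus1[symmetric])
    moreover have "\<phi> (- x) = - \<phi> x" for x using diff[of 0 x] diff[of 0 0] by simp
    ultimately have "\<phi> (axis i 1) \<in> unit_steps" "\<phi> (- axis i 1) \<in> unit_steps" for i by auto
    then show ?thesis using that by (auto simp: unit_steps_def[where 'd='d])
  qed
  then have "bij_betw \<phi> unit_steps unit_steps"
    by (intro bij_betw_byWitness[where f' = \<phi>]) (auto simp: inv)
  moreover have "inj \<phi>" by (metis inv injI)
  moreover have "\<phi> e = e'"
    using s s' by (auto simp: e e' \<phi>_def vec_eq_iff axis_def Transposition.transpose_def)
  ultimately show ?thesis using that diff by blast
qed

lemma reach_unit_steps: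
  fixes e e' :: "int ^ 'd"
  assumes "e \<in> unit_steps" "e' \<in> unit_steps"
  shows "reach n e = reach n e'"
proof -
  obtain \<phi> :: "int ^ 'd \<Rightarrow> int ^ 'd" where \<phi>: "\<phi> e = e'" "\<And>x y. \<phi> (x - y) = \<phi> x - \<phi> y" "inj \<phi>"
    "bij_betw \<phi> unit_steps unit_steps"
    using unit_steps_transitive[OF assms] by blast
  show ?thesis
    using path_prob_map[OF \<phi>(4), of n "\<lambda>xs. visits e' xs \<noteq> 0"] visits_map[OF \<phi>(2,3), of e] \<phi>(1)
    by (simp add: reach_def)
qed

text \<open>After the first step the origin has to be reached from a neighbour, and all neighbours
  are alike by symmetry.\<close>

lemma reach_Suc_0:
  fixes e :: "int ^ 'd"
  assumes "e \<in> unit_steps"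
  shows "reach (Suc n) (0 :: int ^ 'd) = reach n e"
proof -
  have "reach (Suc n) (0 :: int ^ 'd) = step_mean (\<lambda>x::int ^ 'd. reach n e)"
    unfolding reach_Suc using assms by (intro step_mean_cong) (auto intro!: reach_unit_steps)
  then show ?thesis by simp
qed

lemma reach_mono: "m \<le> n \<Longrightarrow> reach m a \<le> reach n a"
proof (induction m arbitrary: n a)
  case (Suc m)
  then obtain n' where "n = Suc n'" "m \<le> n'" by (cases n) auto
  with Suc.IH show ?case by (auto simp: reach_Suc intro!: step_mean_mono)
qed (simp add: reach_nonneg)

lemma hit_mono: "m \<le> n \<Longrightarrow> hit m a b \<le> hit n a b"
proof (induction m arbitrary: n a b)
  case (Suc m)
  then obtain n' where "n = Suc n'" "m \<le> n'" by (cases n) auto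
  with Suc.IH show ?case by (auto simp: hit_Suc intro!: step_mean_mono)
qed (simp add: hit_nonneg)

lemma hit_le_reach: "hit n a b \<le> reach n a"
  by (induction n arbitrary: a b) (auto simp: hit_Suc reach_Suc reach_nonneg intro!: step_mean_mono)

text \<open>The next two lemmas are finite-horizon forms of \<open>reach a = hit a b + hit b a * reach (a - b)\<close>;
  applied to a site and its neighbour in both orders they show that both sites of the pair are
  equally likely to be visited first.\<close>

lemma reach_le_hit:
  assumes "a \<noteq> b" "\<And>m. reach m (a - b) \<le> c"
  shows "reach n a \<le> hit n a b + hit n b a * c"
  using assms
proof (induction n arbitrary: a b)
  case (Suc n)
  have "reach (Suc n) a \<le> step_mean (\<lambda>x.
      (if x = a then 1 else if x = b then 0 else hit n (a - x) (b - x)) +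
      c * (if x = b then 1 else if x = a then 0 else hit n (b - x) (a - x)))"
    unfolding reach_Suc using Suc.prems
    by (intro step_mean_mono) (auto simp: mult.commute[of c] intro!: Suc.IH)
  then show ?case by (simp add: step_mean_add step_mean_cmult hit_Suc mult.commute)
qed simp

lemma reach_ge_hit:
  assumes "a \<noteq> b"
  shows "hit n a b + hit n b a * reach m (a - b) \<le> reach (n + m) a"
  using assms
proof (induction n arbitrary: a b)
  case (Suc n)
  have "step_mean (\<lambda>x.
      (if x = a then 1 else if x = b then 0 else hit n (a - x) (b - x)) +
      reach m (a - b) * (if x = b then 1 else if x = a then 0 else hit n (b - x) (a - x)))
      \<le> reach (Suc (n + m)) a"
    unfolding reach_Suc
  proof (intro step_mean_mono)
    fix x
    show "(if x = a then 1 else if x = b then 0 else hit n (a - x) (b - x)) +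
      reach m (a - b) * (if x = b then 1 else if x = a then 0 else hit n (b - x) (a - x))
      \<le> (if x = a then 1 else reach (n + m) (a - x))"
      using Suc.IH[of "a - x" "b - x"] Suc.prems reach_mono[of m "n + m" "a - b"]
      by (auto simp: mult.commute)
  qed
  then show ?case by (simp add: step_mean_add step_mean_cmult hit_Suc mult.commute)
qed (simp add: reach_nonneg)

text \<open>A superharmonic function with value 1 at the target dominates the probability of
  reaching it. The argument \<open>Suc 0\<close> reflects that at least one step precedes a counted
  visit.\<close>

lemma reach_le_potential:
  fixes a :: "int ^ 'd"
  assumes "4 \<le> CARD('d)"
  shows "reach n a \<le> potential (Suc 0) a"
proof (induction n arbitrary: a)
  case (Suc n)
  have "reach (Suc n) a \<le> step_mean (\<lambda>x. potential 0 (a - x))"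
    unfolding reach_Suc
  proof (intro step_mean_mono)
    fix x
    show "(if x = a then 1 else reach n (a - x)) \<le> potential 0 (a - x)"
      using Suc.IH[of "a - x"] potential_antimono[of 0 "Suc 0" "a - x"] by (auto simp: potential_0_0)
  qed
  also have "\<dots> \<le> potential (Suc 0) a" by (rule step_mean_potential[OF assms])
  finally show ?case .
qed (simp add: potential_nonneg)

text \<open>A longer horizon only adds first visits that happen after time \<open>n\<close>, thus
  after at least n + 1 steps. The bound on them is carried through the induction by
  superharmonicity.\<close>

lemma hit_le_hit_add_potential:
  fixes a b :: "int ^ 'd"
  assumes "4 \<le> CARD('d)"
  shows "hit (n + m) a b \<le> hit n a b + potential (Suc n) a"
proof (induction n arbitrary: a b)
  case 0
  show ?case using hit_le_reach[of m a b] reach_le_potential[OF assms, of m a] by simp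
next
  case (Suc n)
  have "hit (Suc n + m) a b \<le> step_mean (\<lambda>x.
      (if x = a then 1 else if x = b then 0 else hit n (a - x) (b - x)) + potential (Suc n) (a - x))"
    unfolding add_Suc hit_Suc using Suc.IH by (intro step_mean_mono) (auto simp: potential_nonneg)
  also have "\<dots> \<le> hit (Suc n) a b + potential (Suc (Suc n)) a"
    using step_mean_potential[OF assms, of "Suc n" a] by (simp add: step_mean_add hit_Suc)
  finally show ?case .
qed

text \<open>After \<open>n\<close> steps the remaining probability is bounded by
  \<open>potential 0\<close>; each of the \<open>n\<close> steps before is one averaging of the
  potential.\<close>

lemma path_prob_late_visit:
  fixes a :: "int ^ 'd"
  assumes "4 \<le> CARD('d)"
  shows "path_prob (n + m) (\<lambda>xs. visits a xs \<noteq> visits a (take n xs)) \<le> potential n a"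
proof (induction n arbitrary: a)
  case 0
  show ?case using reach_le_potential[OF assms, of m a] potential_antimono[of 0 "Suc 0" a]
    by (simp add: reach_def)
next
  case (Suc n)
  have "path_prob (Suc n + m) (\<lambda>xs. visits a xs \<noteq> visits a (take (Suc n) xs))
    \<le> step_mean (\<lambda>x. potential n (a - x))"
    using Suc.IH by (auto intro!: step_mean_mono)
  also have "\<dots> \<le> potential (Suc n) a" by (rule step_mean_potential[OF assms])
  finally show ?case .
qed

section \<open>The return probability and its relation to \<alpha>\<close>

definition return_lim :: "('d::finite) itself \<Rightarrow> real" where
  "return_lim _ = (SUP n. reach n (0 :: int ^ 'd))"

lemma reach_le_return_lim: "reach n (0 :: int ^ 'd) \<le> return_lim TYPE('d)"
  unfolding return_lim_def by (rule cSUP_upper) (auto intro!: bdd_aboveI2[of _ _ 1] reach_le_1)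

lemma reach_tendsto_return_lim: "(\<lambda>n. reach n (0 :: int ^ 'd)) \<longlonglongrightarrow> return_lim TYPE('d)"
  unfolding return_lim_def
  by (rule LIMSEQ_incseq_SUP) (auto intro!: bdd_aboveI2[of _ _ 1] reach_le_1 incseq_SucI reach_mono)

lemma return_lim_less_1: "4 \<le> CARD('d) \<Longrightarrow> return_lim TYPE('d::finite) < 1"
  using LIMSEQ_le_const2[OF reach_tendsto_return_lim[where 'd='d], of "potential (Suc 0) 0"]
    reach_le_potential[of _ "0 :: int ^ 'd"] potential_1_less_1[of "0 :: int ^ 'd"] by force

lemma return_lim_pos: "0 < return_lim TYPE('d::finite)"
proof -
  obtain e :: "int ^ 'd" where e: "e \<in> unit_steps" unfolding unit_steps_def by blast
  have "(\<Sum>x\<in>unit_steps. if x = e then 1 else reach 0 (e - x)) = (\<Sum>x\<in>unit_steps. if e = x then 1 else 0)"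
    by (intro sum.cong) auto
  then have "0 < (\<Sum>x\<in>unit_steps. if x = e then 1 else reach 0 (e - x))" using e by simp
  then have "0 < reach (Suc 0) e" unfolding reach_Suc step_mean_def by simp
  also have "\<dots> = reach (Suc (Suc 0)) (0 :: int ^ 'd)" using reach_Suc_0[OF e] by simp
  also have "\<dots> \<le> return_lim TYPE('d)" by (rule reach_le_return_lim)
  finally show ?thesis .
qed

text \<open>Since \<open>return_lim\<close> is 1 - \<gamma>, as shown in
  \<open>escape_prob_eq\<close>, this is (1 - \<gamma>) / (2 - \<gamma>).\<close>

definition pair_alpha :: "('d::finite) itself \<Rightarrow> real" where
  "pair_alpha d = return_lim d / (1 + return_lim d)"

lemma pair_alpha_bounds:
  assumes "4 \<le> CARD('d)"
  shows "0 < pair_alpha TYPE('d::finite)" "pair_alpha TYPE('d) < 1 / 2"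
  using return_lim_pos[where 'd='d] return_lim_less_1[OF assms]
  by (auto simp: pair_alpha_def field_simps)

text \<open>A pair of neighbours as seen by a walk that stands on one of them. The form survives
  re-centering at the site visited next, by \<open>origin_pair_shift\<close>.\<close>

definition origin_pair :: "int ^ 'd \<Rightarrow> int ^ 'd \<Rightarrow> bool" where
  "origin_pair a b \<longleftrightarrow> a = 0 \<and> b \<in> unit_steps \<or> b = 0 \<and> a \<in> unit_steps"

text \<open>With r the return probability, the limits satisfy h(a, b) + h(b, a) r = r for both
  orders of the pair. Subtracting gives (h(a, b) - h(b, a)) (1 - r) = 0, so transience forces
  equality, and then h = r / (1 + r).\<close>

lemma hit_tendsto_pair_alpha:
  fixes a b :: "int ^ 'd"
  assumes "4 \<le> CARD('d)" "origin_pair a b"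
  shows "(\<lambda>n. hit n a b) \<longlonglongrightarrow> pair_alpha TYPE('d)"
proof -
  let ?r = "return_lim TYPE('d)"
  define h where "h a b = (SUP n. hit n a b)" for a b :: "int ^ 'd"
  have h: "(\<lambda>n. hit n a b) \<longlonglongrightarrow> h a b" for a b :: "int ^ 'd"
    unfolding h_def
    by (rule LIMSEQ_incseq_SUP) (auto intro!: bdd_aboveI2[of _ _ 1] hit_le_1 incseq_SucI hit_mono)
  have r: "(\<lambda>n. reach n e) \<longlonglongrightarrow> ?r" if "e \<in> unit_steps" for e :: "int ^ 'd"
    using LIMSEQ_Suc[OF reach_tendsto_return_lim[where 'd='d]] reach_Suc_0[OF that] by simp
  have r': "(\<lambda>n. reach n a) \<longlonglongrightarrow> ?r" if "a = 0 \<or> a \<in> unit_steps" for a :: "int ^ 'd"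
    using r reach_tendsto_return_lim that by auto
  have reach_le: "reach n a \<le> ?r" if "a = 0 \<or> a \<in> unit_steps" for n and a :: "int ^ 'd"
    by (rule incseq_le[OF _ r'[OF that]]) (simp add: incseq_def reach_mono)
  have eq: "?r = h a b + h b a * ?r" if "origin_pair a b" for a b :: "int ^ 'd"
  proof -
    have ab: "a \<noteq> b" "a = 0 \<or> a \<in> unit_steps" "a - b = 0 \<or> a - b \<in> unit_steps"
      using that by (auto simp: origin_pair_def)
    show ?thesis
    proof (rule antisym)
      show "?r \<le> h a b + h b a * ?r"
        by (rule LIMSEQ_le[OF r'[OF ab(2)] tendsto_add[OF h tendsto_mult[OF h tendsto_const]]])
          (use reach_le_hit[OF ab(1)] reach_le[OF ab(3)] in auto)
      \<comment> \<open>The horizon \<open>n + n\<close> lets both parameters of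
        \<open>reach_ge_hit\<close> tend to infinity together.\<close>
      have "(\<lambda>n. reach (n + n) a) \<longlonglongrightarrow> ?r"
        using LIMSEQ_subseq_LIMSEQ[OF r'[OF ab(2)], of "\<lambda>n. n + n"]
        by (simp add: strict_mono_def comp_def)
      then show "h a b + h b a * ?r \<le> ?r"
        by (rule LIMSEQ_le[OF tendsto_add[OF h tendsto_mult[OF h r'[OF ab(3)]]]])
          (use reach_ge_hit[OF ab(1)] in auto)
    qed
  qed
  have "origin_pair b a" using assms(2) by (auto simp: origin_pair_def)
  then have "?r = h a b + h b a * ?r" "?r = h b a + h a b * ?r" using eq assms(2) by auto
  then have "(h a b - h b a) * (1 - ?r) = 0" by (simp add: algebra_simps)
  then have "h a b = h b a" using return_lim_less_1[OF assms(1)] by simp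
  then have "h a b * (1 + ?r) = ?r" using eq[OF assms(2)] by (simp add: algebra_simps)
  then have "h a b = pair_alpha TYPE('d)"
    using return_lim_pos[where 'd='d] by (simp add: pair_alpha_def field_simps)
  then show ?thesis using h by metis
qed

lemma hit_le_pair_alpha:
  fixes a b :: "int ^ 'd"
  assumes "4 \<le> CARD('d)" "origin_pair a b"
  shows "hit n a b \<le> pair_alpha TYPE('d)"
  by (rule incseq_le[OF _ hit_tendsto_pair_alpha[OF assms]]) (simp add: incseq_def hit_mono)

text \<open>The missing mass is that of first visits after time \<open>n\<close>, which the
  potential bounds.\<close>

lemma hit_ge_pair_alpha:
  fixes a b :: "int ^ 'd"
  assumes "4 \<le> CARD('d)" "origin_pair a b" "0 < n"
  shows "pair_alpha TYPE('d) - 23 / sqrt (real n) \<le> hit n a b"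
proof -
  have "(\<lambda>m. hit (n + m) a b) \<longlonglongrightarrow> pair_alpha TYPE('d)"
    using LIMSEQ_ignore_initial_segment[OF hit_tendsto_pair_alpha[OF assms(1,2)], of n]
    by (simp add: add.commute)
  then have "pair_alpha TYPE('d) \<le> hit n a b + potential (Suc n) a"
    by (rule LIMSEQ_le_const2) (auto intro: hit_le_hit_add_potential[OF assms(1)])
  also have "potential (Suc n) a \<le> potential n a" by (rule potential_antimono) simp
  also have "\<dots> \<le> 23 / sqrt (real n)" by (rule potential_le[OF assms(3)])
  finally show ?thesis by simp
qed

section \<open>Visits to a pair of neighbours\<close>

definition passes :: "int ^ 'd \<Rightarrow> int ^ 'd \<Rightarrow> nat \<Rightarrow> nat \<Rightarrow> (int ^ 'd) list \<Rightarrow> bool" where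
  "passes a b k l xs \<longleftrightarrow> (\<exists>i\<le>length xs. visits a (take i xs) = k \<and> visits b (take i xs) = l)"

text \<open>The quiet final stretch of \<open>w\<close> steps separates the counted visits from any
  return after the end of the list, so that such a return is a late one and has small
  probability.\<close>

definition settled :: "nat \<Rightarrow> int ^ 'd \<Rightarrow> int ^ 'd \<Rightarrow> nat \<Rightarrow> nat \<Rightarrow> (int ^ 'd) list \<Rightarrow> bool" where
  "settled w a b k l xs \<longleftrightarrow> w \<le> length xs \<and> visits a xs = k \<and> visits b xs = l \<and>
    visits a (take (length xs - w) xs) = k \<and> visits b (take (length xs - w) xs) = l"

lemma settled_imp_passes: "settled w a b k l xs \<Longrightarrow> passes a b k l (take (length xs - w) xs)"
  unfolding settled_def passes_def by (intro exI[of _ "length xs - w"]) simp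

lemma passes_Cons:
  assumes "a \<noteq> b" "0 < k \<or> 0 < l"
  shows "passes a b k l (x # xs) \<longleftrightarrow>
    (if x = a then 0 < k \<and> passes 0 (b - a) (k - 1) l xs
     else if x = b then 0 < l \<and> passes (a - b) 0 k (l - 1) xs
     else passes (a - x) (b - x) k l xs)"
proof -
  \<comment> \<open>The empty prefix has counts (0, 0) and is excluded by the assumption; every
    other prefix begins with \<open>x\<close>.\<close>
  have "passes a b k l (x # xs) \<longleftrightarrow> (\<exists>i\<le>length xs.
      of_bool (x = a) + visits (a - x) (take i xs) = k \<and> of_bool (x = b) + visits (b - x) (take i xs) = l)"
    unfolding passes_def using assms(2)
    by (simp only: less_Suc_eq_le[symmetric] length_Cons Ex_less_Suc2) auto
  then show ?thesis using assms by (auto simp: passes_def)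
qed

lemma settled_Cons:
  assumes "a \<noteq> b" "w \<le> length xs"
  shows "settled w a b k l (x # xs) \<longleftrightarrow>
    (if x = a then 0 < k \<and> settled w 0 (b - a) (k - 1) l xs
     else if x = b then 0 < l \<and> settled w (a - b) 0 k (l - 1) xs
     else settled w (a - x) (b - x) k l xs)"
  using assms by (auto simp: settled_def Suc_diff_le)

text \<open>Decomposition at the first visit to \<open>{a, b}\<close>; the guards \<open>0 < k\<close> and \<open>0 < l\<close> neutralize the
  truncated subtractions.\<close>

lemma path_prob_passes_step:
  assumes "a \<noteq> b" "0 < k \<or> 0 < l"
    and "\<And>t. path_prob t (\<lambda>xs. 0 < k \<and> passes 0 (b - a) (k - 1) l xs) \<le> A"
    and "\<And>t. path_prob t (\<lambda>xs. 0 < l \<and> passes (a - b) 0 k (l - 1) xs) \<le> B"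
  shows "path_prob T (passes a b k l) \<le> A * hit T a b + B * hit T b a"
  using assms
proof (induction T arbitrary: a b)
  case (Suc T)
  have "path_prob (Suc T) (passes a b k l) \<le> step_mean (\<lambda>x.
      A * (if x = a then 1 else if x = b then 0 else hit T (a - x) (b - x)) +
      B * (if x = b then 1 else if x = a then 0 else hit T (b - x) (a - x)))"
    unfolding path_prob.simps passes_Cons[OF Suc.prems(1,2)]
    using Suc.prems by (intro step_mean_mono) (auto intro!: Suc.IH)
  then show ?case by (simp add: step_mean_add step_mean_cmult hit_Suc)
qed (simp add: passes_def)

text \<open>Only first visits within \<open>n\<close> steps are used, so at least \<open>t0\<close>
  steps remain after them and the bounds \<open>A\<close> and \<open>B\<close> apply.\<close>

lemma path_prob_settled_step:
  assumes "a \<noteq> b" "w \<le> t0" "t0 + n \<le> T"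
    and "\<And>t. t0 \<le> t \<Longrightarrow> A \<le> path_prob t (\<lambda>xs. 0 < k \<and> settled w 0 (b - a) (k - 1) l xs)"
    and "\<And>t. t0 \<le> t \<Longrightarrow> B \<le> path_prob t (\<lambda>xs. 0 < l \<and> settled w (a - b) 0 k (l - 1) xs)"
  shows "A * hit n a b + B * hit n b a \<le> path_prob T (settled w a b k l)"
  using assms
proof (induction n arbitrary: a b T)
  case (Suc n)
  then obtain T' where T: "T = Suc T'" "t0 + n \<le> T'" by (cases T) auto
  have "step_mean (\<lambda>x.
      A * (if x = a then 1 else if x = b then 0 else hit n (a - x) (b - x)) +
      B * (if x = b then 1 else if x = a then 0 else hit n (b - x) (a - x)))
      \<le> path_prob T (settled w a b k l)"
    unfolding T(1) path_prob.simps
  proof (intro step_mean_mono)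
    fix x
    have "path_prob T' (\<lambda>xs. settled w a b k l (x # xs)) = path_prob T' (\<lambda>xs.
      if x = a then 0 < k \<and> settled w 0 (b - a) (k - 1) l xs
      else if x = b then 0 < l \<and> settled w (a - b) 0 k (l - 1) xs
      else settled w (a - x) (b - x) k l xs)"
      using Suc.prems(1,2) T(2) by (intro path_prob_cong settled_Cons) auto
    moreover have "A * hit n (a - x) (b - x) + B * hit n (b - x) (a - x)
        \<le> path_prob T' (settled w (a - x) (b - x) k l)"
      using Suc.prems T by (intro Suc.IH) auto
    ultimately show "A * (if x = a then 1 else if x = b then 0 else hit n (a - x) (b - x)) +
      B * (if x = b then 1 else if x = a then 0 else hit n (b - x) (a - x))
      \<le> path_prob T' (\<lambda>xs. settled w a b k l (x # xs))"
      using Suc.prems T by auto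
  qed
  then show ?case by (simp add: step_mean_add step_mean_cmult hit_Suc)
qed (simp add: path_prob_nonneg)

section \<open>Binomial weights of the visit counts\<close>

definition pair_weight :: "real \<Rightarrow> nat \<Rightarrow> nat \<Rightarrow> real" where
  "pair_weight \<alpha> k l = real ((k + l) choose k) * \<alpha> ^ (k + l)"

lemma pair_weight_0_0 [simp]: "pair_weight \<alpha> 0 0 = 1"
  by (simp add: pair_weight_def)

lemma pair_weight_nonneg: "0 \<le> \<alpha> \<Longrightarrow> 0 \<le> pair_weight \<alpha> k l"
  by (simp add: pair_weight_def)

text \<open>Pascal's rule mirrors the decomposition at the first visit: the two summands are the two
  choices of the site visited first.\<close>

lemma pair_weight_pascal:
  assumes "0 < k \<or> 0 < l"
  shows "pair_weight \<alpha> k l =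
    ((if 0 < k then pair_weight \<alpha> (k - 1) l else 0) + (if 0 < l then pair_weight \<alpha> k (l - 1) else 0)) * \<alpha>"
proof (cases k; cases l)
  fix k' l' assume "k = Suc k'" "l = Suc l'"
  then show ?thesis by (simp add: pair_weight_def algebra_simps)
qed (use assms in \<open>auto simp: pair_weight_def\<close>)

lemma origin_pair_neq: "origin_pair a b \<Longrightarrow> a \<noteq> b"
  by (auto simp: origin_pair_def)

lemma origin_pair_shift: "origin_pair a b \<Longrightarrow> origin_pair 0 (b - a) \<and> origin_pair (a - b) 0"
  by (auto simp: origin_pair_def)

text \<open>Induction on the number of visits: each visit goes to a prescribed site with probability
  at most \<alpha>, and Pascal's rule sums over the orders of the visits.\<close>

lemma path_prob_passes_le:
  fixes a b :: "int ^ 'd"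
  assumes d: "4 \<le> CARD('d)" and "origin_pair a b"
  shows "path_prob T (passes a b k l) \<le> pair_weight (pair_alpha TYPE('d)) k l"
  using assms(2)
proof (induction "k + l" arbitrary: k l a b T)
  case 0
  then show ?case by (simp add: path_prob_le_1)
next
  case (Suc n)
  let ?\<alpha> = "pair_alpha TYPE('d)"
  let ?A = "if 0 < k then pair_weight ?\<alpha> (k - 1) l else 0"
  let ?B = "if 0 < l then pair_weight ?\<alpha> k (l - 1) else 0"
  have kl: "0 < k \<or> 0 < l" using Suc.hyps(2) by auto
  have nonneg: "0 \<le> ?A" "0 \<le> ?B"
    using pair_alpha_bounds[OF d] by (auto simp: pair_weight_nonneg)
  have "path_prob T (passes a b k l) \<le> ?A * hit T a b + ?B * hit T b a"
    using Suc origin_pair_shift[OF Suc.prems] origin_pair_neq[OF Suc.prems] kl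
    by (intro path_prob_passes_step) auto
  also have "\<dots> \<le> ?A * ?\<alpha> + ?B * ?\<alpha>"
    using nonneg Suc.prems
    by (intro add_mono mult_left_mono hit_le_pair_alpha[OF d]) (auto simp: origin_pair_def)
  also have "\<dots> = pair_weight ?\<alpha> k l"
    using pair_weight_pascal[OF kl, of ?\<alpha>] by (simp add: algebra_simps)
  finally show ?case .
qed

lemma path_prob_no_visit_ge:
  fixes a b :: "int ^ 'd"
  assumes d: "4 \<le> CARD('d)" and "origin_pair a b"
  shows "1 - 2 * pair_alpha TYPE('d) \<le> path_prob T (\<lambda>xs. visits a xs = 0 \<and> visits b xs = 0)"
  using hit_le_pair_alpha[OF d, of a b T] hit_le_pair_alpha[OF d, of b a T] assms(2)
  by (subst path_prob_no_visit) (auto simp: origin_pair_def)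

text \<open>Each of the k + l visits is allotted \<open>n\<close> steps, which costs 23 / sqrt n in
  its probability and turns \<alpha> into \<beta>. The remaining steps, at least \<open>w\<close> of
  them, avoid the pair with probability at least 1 - 2 \<alpha>.\<close>

lemma path_prob_settled_ge:
  fixes a b :: "int ^ 'd"
  assumes d: "4 \<le> CARD('d)" and "origin_pair a b"
    and n: "0 < n" and \<beta>: "\<beta> = pair_alpha TYPE('d) - 23 / sqrt (real n)" "0 \<le> \<beta>"
    and "(k + l) * n + w \<le> T"
  shows "(1 - 2 * pair_alpha TYPE('d)) * pair_weight \<beta> k l \<le> path_prob T (settled w a b k l)"
  using assms(2,6)
proof (induction "k + l" arbitrary: k l a b T)
  case 0
  have "path_prob T (\<lambda>xs. visits a xs = 0 \<and> visits b xs = 0) \<le> path_prob T (settled w a b k l)"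
  proof (rule path_prob_mono)
    fix xs assume "length xs = T" "visits a xs = 0 \<and> visits b xs = 0"
    with 0 show "settled w a b k l xs"
      using visits_take_le[of a _ xs] visits_take_le[of b _ xs] by (simp add: settled_def)
  qed
  then show ?case using path_prob_no_visit_ge[OF d, of a b T] 0 by simp
next
  case (Suc m)
  let ?c = "1 - 2 * pair_alpha TYPE('d)"
  let ?A = "?c * (if 0 < k then pair_weight \<beta> (k - 1) l else 0)"
  let ?B = "?c * (if 0 < l then pair_weight \<beta> k (l - 1) else 0)"
  have kl: "0 < k \<or> 0 < l" using Suc.hyps(2) by auto
  have c: "0 \<le> ?c" using pair_alpha_bounds[OF d] by simp
  have nonneg: "0 \<le> ?A" "0 \<le> ?B"
    using c \<beta>(2) by (auto simp: pair_weight_nonneg)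
  have "?c * pair_weight \<beta> k l = ?A * \<beta> + ?B * \<beta>"
    using pair_weight_pascal[OF kl, of \<beta>] by (simp add: algebra_simps)
  also have "\<dots> \<le> ?A * hit n a b + ?B * hit n b a"
    using nonneg Suc.prems n unfolding \<beta>(1)
    by (intro add_mono mult_left_mono hit_ge_pair_alpha[OF d]) (auto simp: origin_pair_def)
  also have "\<dots> \<le> path_prob T (settled w a b k l)"
  proof (rule path_prob_settled_step[where ?t0.0 = "m * n + w"])
    show "m * n + w + n \<le> T" using Suc.prems(2) Suc.hyps(2)[symmetric] by simp
    show "?A \<le> path_prob t (\<lambda>xs. 0 < k \<and> settled w 0 (b - a) (k - 1) l xs)" if "m * n + w \<le> t" for t
      using Suc.hyps(1)[of "k - 1" l 0 "b - a" t] Suc.hyps(2) origin_pair_shift[OF Suc.prems(1)] that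
      by (cases k) (auto simp: path_prob_nonneg)
    show "?B \<le> path_prob t (\<lambda>xs. 0 < l \<and> settled w (a - b) 0 k (l - 1) xs)" if "m * n + w \<le> t" for t
      using Suc.hyps(1)[of k "l - 1" "a - b" 0 t] Suc.hyps(2) origin_pair_shift[OF Suc.prems(1)] that
      by (cases l) (auto simp: path_prob_nonneg)
  qed (use origin_pair_neq[OF Suc.prems(1)] in auto)
  finally show ?case .
qed

section \<open>The rate function and its comparison with the weights\<close>

definition pair_rate :: "real \<Rightarrow> real \<Rightarrow> real \<Rightarrow> real" where
  "pair_rate \<alpha> x y = - (x + y) * ln (x + y) + x * ln x + y * ln y - (x + y) * ln \<alpha>"

lemma pair_rate_commute: "pair_rate \<alpha> x y = pair_rate \<alpha> y x"
  by (simp add: pair_rate_def add.commute)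

lemma pair_rate_0_0 [simp]: "pair_rate \<alpha> 0 0 = 0"
  by (simp add: pair_rate_def)

text \<open>The terms with ln c have total coefficient proportional to - (x + y) + x + y =
  0.\<close>

lemma pair_rate_scale:
  assumes "0 < c" "0 \<le> x" "0 \<le> y"
  shows "pair_rate \<alpha> (c * x) (c * y) = c * pair_rate \<alpha> x y"
proof -
  have "c * u * ln (c * u) = c * (u * ln u) + c * u * ln c" if "0 \<le> u" for u
    using that assms(1) by (cases "u = 0") (auto simp: ln_mult algebra_simps)
  from this[of x] this[of y] this[of "x + y"] show ?thesis
    using assms by (simp add: pair_rate_def algebra_simps)
qed

lemma scaled_region_B_iff:
  assumes "0 < c" "0 \<le> x" "0 \<le> y"
  shows "(x, y) \<in> (\<lambda>p. c *\<^sub>R p) ` region_B \<alpha> \<longleftrightarrow> pair_rate \<alpha> x y \<le> c"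
proof -
  have "(x, y) \<in> (\<lambda>p. c *\<^sub>R p) ` region_B \<alpha> \<longleftrightarrow> (x / c, y / c) \<in> region_B \<alpha>"
    using assms(1) by (force simp: image_iff)
  also have "\<dots> \<longleftrightarrow> pair_rate \<alpha> (x / c) (y / c) \<le> 1"
    using assms by (simp add: region_B_def pair_rate_def)
  also have "\<dots> \<longleftrightarrow> pair_rate \<alpha> x y \<le> c"
    using pair_rate_scale[of "1 / c" x y \<alpha>] assms by simp
  finally show ?thesis .
qed

text \<open>The entropy of splitting x + y into x and y is at most (x + y) ln 2. In the applications
  2 \<alpha> < 1, so the rate grows at least linearly; this bounds the counts in part (ii) and
  yields a geometric series in part (i).\<close>

lemma pair_rate_ge:
  assumes "0 \<le> x" "0 \<le> y" "0 < \<alpha>"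
  shows "(x + y) * - ln (2 * \<alpha>) \<le> pair_rate \<alpha> x y"
proof (cases "x = 0 \<or> y = 0")
  case True
  then show ?thesis using assms by (auto simp: pair_rate_def ln_mult algebra_simps)
next
  case False
  then have xy: "0 < x" "0 < y" using assms by auto
  \<comment> \<open>This is ln s <= s - 1 at s = (x + y) / (2 u). The right sides for u = x and u =
    y sum to 0.\<close>
  have aux: "u * ln (x + y) - u * ln u - u * ln 2 \<le> (x + y) / 2 - u" if "0 < u" for u
  proof -
    have "u * ln ((x + y) / (2 * u)) \<le> u * ((x + y) / (2 * u) - 1)"
      using xy that by (intro mult_left_mono ln_le_minus_one) auto
    also have "\<dots> = (x + y) / 2 - u" using that by (simp add: right_diff_distrib)
    also have "u * ln ((x + y) / (2 * u)) = u * ln (x + y) - u * ln u - u * ln 2"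
      using xy that by (simp add: ln_div ln_mult algebra_simps)
    finally show ?thesis .
  qed
  from aux[OF xy(1)] aux[OF xy(2)] show ?thesis
    using assms by (simp add: pair_rate_def ln_mult algebra_simps)
qed

text \<open>The conventions 0 ^ 0 = 1 and 0 * ln 0 = 0 agree.\<close>

lemma exp_mult_ln_nat: "exp (real n * ln (real n)) = real n ^ n"
  by (cases "n = 0") (auto simp: exp_of_nat_mult)

lemma exp_uminus_pair_rate:
  assumes "0 < \<alpha>"
  shows "exp (- pair_rate \<alpha> (real k) (real l)) =
    real (k + l) ^ (k + l) / (real k ^ k * real l ^ l) * \<alpha> ^ (k + l)"
proof -
  have "- pair_rate \<alpha> (real k) (real l) = real (k + l) * ln (real (k + l))
      + - (real k * ln (real k)) + - (real l * ln (real l)) + real (k + l) * ln \<alpha>"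
    by (simp add: pair_rate_def algebra_simps)
  moreover have "exp (real (k + l) * ln \<alpha>) = \<alpha> ^ (k + l)"
    using assms by (simp only: exp_of_nat_mult exp_ln)
  ultimately show ?thesis
    by (simp only: exp_add exp_minus exp_mult_ln_nat) (simp add: field_simps)
qed

text \<open>The binomial coefficient times k^k l^l is a single term in the expansion of (k + l)^(k +
  l).\<close>

lemma pair_weight_le:
  assumes "0 < \<alpha>"
  shows "pair_weight \<alpha> k l \<le> exp (- pair_rate \<alpha> (real k) (real l))"
proof -
  have "real ((k + l) choose k) * real k ^ k * real l ^ (k + l - k)
      \<le> (\<Sum>i\<le>k + l. real ((k + l) choose i) * real k ^ i * real l ^ (k + l - i))"
    by (rule member_le_sum) auto
  also have "\<dots> = real (k + l) ^ (k + l)"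
    by (simp add: binomial_ring)
  finally have "real ((k + l) choose k) * (real k ^ k * real l ^ l) \<le> real (k + l) ^ (k + l)"
    by (simp add: mult.assoc)
  moreover have "0 < real k ^ k * real l ^ l" by (cases k; cases l) auto
  ultimately have "real ((k + l) choose k) \<le> real (k + l) ^ (k + l) / (real k ^ k * real l ^ l)"
    by (simp only: pos_le_divide_eq)
  then show ?thesis
    unfolding exp_uminus_pair_rate[OF assms] pair_weight_def
    using assms by (intro mult_right_mono) auto
qed

text \<open>A weak form of Stirling's formula, by induction from (1 + 1/n)^n <= e <= (1 + 1/n)^(n +
  1).\<close>

lemma fact_bounds:
  assumes "0 < n"
  shows "real n ^ n * exp 1 \<le> fact n * exp (real n)"
    and "fact n * exp (real n) \<le> exp 1 * real n * real n ^ n"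
proof -
  have "real n ^ n * exp 1 \<le> fact n * exp (real n) \<and>
      fact n * exp (real n) \<le> exp 1 * real n * real n ^ n"
    using assms
  proof (induction n rule: nat_induct_non_zero)
    case (Suc n)
    let ?n = "real n"
    have "(1 + 1 / ?n) ^ n \<le> exp (1 / ?n) ^ n"
      using Suc.hyps exp_ge_add_one_self[of "1 / ?n"] by (intro power_mono) auto
    also have "\<dots> = exp 1" using Suc.hyps by (simp add: exp_of_nat_mult[symmetric])
    finally have "(1 + 1 / ?n) ^ n * ?n ^ n \<le> exp 1 * ?n ^ n" by (intro mult_right_mono) auto
    moreover have "(1 + 1 / ?n) ^ n * ?n ^ n = (?n + 1) ^ n"
      using Suc.hyps by (simp add: power_mult_distrib[symmetric] field_simps)
    ultimately have 1: "(?n + 1) ^ n \<le> exp 1 * ?n ^ n" by simp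
    \<comment> \<open>The inequality e <= (1 + 1/n)^(n + 1), obtained through reciprocals.\<close>
    have "?n / (?n + 1) \<le> exp (- (1 / (?n + 1)))"
      using exp_ge_add_one_self[of "- (1 / (?n + 1))"] by (simp add: field_simps)
    then have "(?n / (?n + 1)) ^ Suc n \<le> exp (- (1 / (?n + 1))) ^ Suc n"
      by (intro power_mono) auto
    also have "\<dots> = exp (- 1)" by (simp add: exp_of_nat_mult[symmetric] field_simps del: power_Suc)
    finally have "?n ^ Suc n * exp 1 \<le> (?n + 1) ^ Suc n"
      by (simp add: power_divide exp_minus field_simps del: power_Suc)
    then have 2: "?n ^ n * ?n * exp 1 \<le> (?n + 1) ^ Suc n" by (simp add: mult.commute)
    have "real (Suc n) ^ Suc n * exp 1 = (?n + 1) * exp 1 * (?n + 1) ^ n" by (simp add: algebra_simps)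
    also have "\<dots> \<le> (?n + 1) * exp 1 * (exp 1 * ?n ^ n)" using 1 by (intro mult_left_mono) auto
    also have "\<dots> \<le> (?n + 1) * exp 1 * (fact n * exp ?n)"
      using Suc.IH by (intro mult_left_mono) (auto simp: mult.commute)
    also have "\<dots> = fact (Suc n) * exp (real (Suc n))" by (simp add: exp_add algebra_simps)
    finally have A: "real (Suc n) ^ Suc n * exp 1 \<le> fact (Suc n) * exp (real (Suc n))" .
    have "fact (Suc n) * exp (real (Suc n)) = (?n + 1) * exp 1 * (fact n * exp ?n)"
      by (simp add: exp_add algebra_simps)
    also have "\<dots> \<le> (?n + 1) * exp 1 * (exp 1 * ?n * ?n ^ n)"
      using Suc.IH by (intro mult_left_mono) auto
    also have "\<dots> = (?n + 1) * exp 1 * (?n ^ n * ?n * exp 1)" by simp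
    also have "\<dots> \<le> (?n + 1) * exp 1 * (?n + 1) ^ Suc n" using 2 by (intro mult_left_mono) auto
    also have "\<dots> = exp 1 * real (Suc n) * real (Suc n) ^ Suc n" by (simp add: mult.commute add.commute)
    finally show ?case using A by simp
  qed simp
  then show "real n ^ n * exp 1 \<le> fact n * exp (real n)"
    and "fact n * exp (real n) \<le> exp 1 * real n * real n ^ n" by auto
qed

text \<open>The factorial bounds are applied to (k + l)!, k! and l!, with e <= 3. The factors k + 1
  and l + 1 instead of k and l also cover k = 0 or l = 0.\<close>

lemma pair_weight_ge:
  assumes "0 < \<alpha>"
  shows "exp (- pair_rate \<alpha> (real k) (real l)) \<le> 3 * real (k + 1) * real (l + 1) * pair_weight \<alpha> k l"
proof -
  let ?E = "real (k + l) ^ (k + l) / (real k ^ k * real l ^ l)"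
  have "?E \<le> 3 * real (k + 1) * real (l + 1) * real ((k + l) choose k)"
  proof (cases "k = 0 \<or> l = 0")
    case True
    then show ?thesis by (auto simp: field_simps)
  next
    case False
    then have pos: "0 < k" "0 < l" by auto
    have "real (k + l) ^ (k + l) * exp 1 \<le> fact (k + l) * exp (real (k + l))"
      using fact_bounds(1)[of "k + l"] pos by simp
    also have "fact (k + l) = real ((k + l) choose k) * (fact k * fact l)"
      using arg_cong[OF binomial_fact_lemma[OF le_add1[of k l]], of real] by (simp add: mult_ac)
    also have "\<dots> * exp (real (k + l)) = real ((k + l) choose k) * ((fact k * exp (real k)) * (fact l * exp (real l)))"
      by (simp add: exp_add)
    also have "\<dots> \<le> real ((k + l) choose k) * ((exp 1 * real k * real k ^ k) * (exp 1 * real l * real l ^ l))"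
      by (intro mult_left_mono mult_mono[OF fact_bounds(2)[OF pos(1)] fact_bounds(2)[OF pos(2)]]) auto
    also have "\<dots> = (exp 1 * real k * real l * real ((k + l) choose k) * (real k ^ k * real l ^ l)) * exp 1"
      by simp
    finally have "real (k + l) ^ (k + l) \<le> exp 1 * real k * real l * real ((k + l) choose k) * (real k ^ k * real l ^ l)"
      by (simp only: mult_le_cancel_right) simp
    then have "?E \<le> exp 1 * real k * real l * real ((k + l) choose k)"
      using pos by (simp add: field_simps)
    also have "\<dots> \<le> 3 * real (k + 1) * real (l + 1) * real ((k + l) choose k)"
      using exp_le by (intro mult_right_mono mult_mono) auto
    finally show ?thesis .
  qed
  then have "?E * \<alpha> ^ (k + l) \<le> 3 * real (k + 1) * real (l + 1) * real ((k + l) choose k) * \<alpha> ^ (k + l)"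
    using assms by (intro mult_right_mono) auto
  then show ?thesis unfolding exp_uminus_pair_rate[OF assms] pair_weight_def by (simp add: mult.assoc)
qed

text \<open>This pays a factor 1 / \<alpha> for the first visit to the pair: the visits after it
  number (k, l), whereas the rate concerns (k + 1, l).\<close>

lemma pair_weight_Suc_le:
  assumes "0 < \<alpha>"
  shows "pair_weight \<alpha> k l \<le> pair_weight \<alpha> (Suc k) l / \<alpha>"
proof -
  have "real ((k + l) choose k) \<le> real (Suc (k + l) choose Suc k)" by simp
  then have "real ((k + l) choose k) * \<alpha> ^ (k + l) \<le> real (Suc (k + l) choose Suc k) * \<alpha> ^ (k + l)"
    using assms by (intro mult_right_mono) auto
  then show ?thesis using assms by (simp add: pair_weight_def del: binomial_Suc_Suc)
qed

text \<open>The walk starts on the pair, and this visit is the \<open>Suc\<close>. The share 1 -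
  \<delta> of the rate is bounded below by \<open>L\<close>, the share \<delta> by
  \<open>pair_rate_ge\<close>. The latter gives a geometric series in k and l, so the union over all
  counts costs only a constant.\<close>

lemma path_prob_rate_exceeds:
  fixes e :: "int ^ 'd"
  assumes d: "4 \<le> CARD('d)" and e: "e \<in> unit_steps" and \<delta>: "0 < \<delta>" "\<delta> < 1"
    and \<alpha>_def: "\<alpha> = pair_alpha TYPE('d)"
  shows "path_prob T (\<lambda>xs. \<exists>i\<le>T. L < pair_rate \<alpha> (real (Suc (visits 0 (take i xs)))) (real (visits e (take i xs))))
    \<le> exp (- (1 - \<delta>) * L) / (\<alpha> * (1 - (2 * \<alpha>) powr \<delta>)\<^sup>2)"
proof -
  have \<alpha>: "0 < \<alpha>" "2 * \<alpha> < 1" using pair_alpha_bounds[OF d] by (auto simp: \<alpha>_def)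
  define \<rho> where "\<rho> = (2 * \<alpha>) powr \<delta>"
  have \<rho>: "0 < \<rho>" "\<rho> < 1" using \<alpha> \<delta> powr_less_mono2[of \<delta> "2 * \<alpha>" 1] by (auto simp: \<rho>_def)
  let ?R = "\<lambda>k l. pair_rate \<alpha> (real (Suc k)) (real l)"
  have term_le: "path_prob T (\<lambda>xs. L < ?R k l \<and> passes 0 e k l xs) \<le> exp (- (1 - \<delta>) * L) / \<alpha> * (\<rho> ^ k * \<rho> ^ l)" for k l
  proof (cases "L < ?R k l")
    case True
    have "path_prob T (\<lambda>xs. L < ?R k l \<and> passes 0 e k l xs) = path_prob T (passes 0 e k l)"
      using True by (intro path_prob_cong) auto
    also have "\<dots> \<le> pair_weight \<alpha> k l"
      using e unfolding \<alpha>_def by (intro path_prob_passes_le[OF d]) (simp add: origin_pair_def)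
    also have "\<dots> \<le> pair_weight \<alpha> (Suc k) l / \<alpha>" by (rule pair_weight_Suc_le[OF \<alpha>(1)])
    also have "\<dots> \<le> exp (- ?R k l) / \<alpha>"
      using pair_weight_le[OF \<alpha>(1), of "Suc k" l] \<alpha> by (intro divide_right_mono) auto
    also have "- ?R k l \<le> - (1 - \<delta>) * L + \<delta> * (real (k + l) * ln (2 * \<alpha>))"
    proof -
      have "(1 - \<delta>) * L \<le> (1 - \<delta>) * ?R k l" using True \<delta> by (intro mult_left_mono) auto
      moreover have "real (k + l) * - ln (2 * \<alpha>) \<le> (real (Suc k) + real l) * - ln (2 * \<alpha>)"
        using \<alpha> by (intro mult_right_mono) auto
      then have "real (k + l) * - ln (2 * \<alpha>) \<le> ?R k l"
        using pair_rate_ge[of "real (Suc k)" "real l" \<alpha>] \<alpha> by linarith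
      then have "\<delta> * (real (k + l) * - ln (2 * \<alpha>)) \<le> \<delta> * ?R k l"
        using \<delta> by (intro mult_left_mono) auto
      ultimately show ?thesis by (simp add: algebra_simps)
    qed
    also have "exp (- (1 - \<delta>) * L + \<delta> * (real (k + l) * ln (2 * \<alpha>))) = exp (- (1 - \<delta>) * L) * \<rho> ^ (k + l)"
      using \<alpha> by (simp add: exp_add \<rho>_def powr_def exp_of_nat_mult[symmetric] mult_ac)
    finally show ?thesis using \<alpha> by (simp add: power_add divide_right_mono)
  next
    case False
    then show ?thesis using \<alpha> \<rho> by simp
  qed
  have geo: "(\<Sum>k\<le>T. \<rho> ^ k) \<le> 1 / (1 - \<rho>)"
    using sum_le_suminf[of "\<lambda>k. \<rho> ^ k" "{..T}"] \<rho> by (simp add: suminf_geometric summable_geometric)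
  have "path_prob T (\<lambda>xs. \<exists>i\<le>T. L < ?R (visits 0 (take i xs)) (visits e (take i xs)))
    \<le> path_prob T (\<lambda>xs. \<exists>(k, l)\<in>{..T} \<times> {..T}. L < ?R k l \<and> passes 0 e k l xs)"
  proof (rule path_prob_mono)
    fix xs assume xs: "length xs = T" "\<exists>i\<le>T. L < ?R (visits 0 (take i xs)) (visits e (take i xs))"
    then obtain i where i: "i \<le> T" "L < ?R (visits 0 (take i xs)) (visits e (take i xs))" by blast
    moreover have "visits z (take i xs) \<le> T" for z
      using visits_le_length[of z "take i xs"] xs(1) by simp
    moreover have "passes 0 e (visits 0 (take i xs)) (visits e (take i xs)) xs"
      using i(1) xs(1) by (auto simp: passes_def)
    ultimately show "\<exists>(k, l)\<in>{..T} \<times> {..T}. L < ?R k l \<and> passes 0 e k l xs" by fast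
  qed
  also have "\<dots> \<le> (\<Sum>(k, l)\<in>{..T} \<times> {..T}. path_prob T (\<lambda>xs. L < ?R k l \<and> passes 0 e k l xs))"
    using path_prob_Bex[of "{..T} \<times> {..T}" T "\<lambda>(k, l) xs. L < ?R k l \<and> passes 0 e k l xs"]
    by (simp add: case_prod_unfold)
  also have "\<dots> \<le> (\<Sum>(k, l)\<in>{..T} \<times> {..T}. exp (- (1 - \<delta>) * L) / \<alpha> * (\<rho> ^ k * \<rho> ^ l))"
    using term_le by (intro sum_mono) auto
  also have "\<dots> = exp (- (1 - \<delta>) * L) / \<alpha> * ((\<Sum>k\<le>T. \<rho> ^ k) * (\<Sum>l\<le>T. \<rho> ^ l))"
    unfolding sum_product sum.cartesian_product case_prod_unfold by (simp only: sum_distrib_left)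
  also have "\<dots> \<le> exp (- (1 - \<delta>) * L) / \<alpha> * (1 / (1 - \<rho>) * (1 / (1 - \<rho>)))"
    using geo \<rho> \<alpha> by (intro mult_left_mono mult_mono) (auto intro!: sum_nonneg)
  also have "\<dots> = exp (- (1 - \<delta>) * L) / (\<alpha> * (1 - \<rho>)\<^sup>2)"
    by (simp add: power2_eq_square)
  finally show ?thesis by (simp add: \<rho>_def)
qed

section \<open>Sparse good times\<close>

lemma first_at_decompose:
  assumes "first_at a b xs" "a \<noteq> b"
  obtains j where "0 < j" "j \<le> length xs"
    "visits a xs = Suc (visits 0 (drop j xs))" "visits b xs = visits (b - a) (drop j xs)"
proof -
  have "\<exists>j. 0 < j \<and> j \<le> length xs \<and> visits a xs = Suc (visits 0 (drop j xs)) \<and>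
      visits b xs = visits (b - a) (drop j xs)"
    using assms
  proof (induction xs arbitrary: a b)
    case (Cons x xs)
    show ?case
    proof (cases "x = a")
      case True
      then show ?thesis using Cons.prems by (intro exI[of _ 1]) auto
    next
      case False
      then have "first_at (a - x) (b - x) xs" "x \<noteq> b" using Cons.prems by auto
      with Cons.IH[of "a - x" "b - x"] Cons.prems obtain j where "0 < j" "j \<le> length xs"
        "visits (a - x) xs = Suc (visits 0 (drop j xs))" "visits (b - x) xs = visits (b - a) (drop j xs)"
        by auto
      then show ?thesis using False \<open>x \<noteq> b\<close> by (intro exI[of _ "Suc j"]) auto
    qed
  qed simp
  then show ?thesis using that by blast
qed

lemma unit_step_neq_0: "e \<in> unit_steps \<Longrightarrow> e \<noteq> 0"
  using zero_notin_unit_steps by metis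

text \<open>The infinitely many \<open>z\<close> are replaced by the N possible times of the first
  visit to the pair and the 2 d directions from the site visited first to the other one. From that
  time on \<open>path_prob_rate_exceeds\<close> applies.\<close>

lemma path_prob_rate_exceeds_somewhere:
  assumes d: "4 \<le> CARD('d)" and \<delta>: "0 < \<delta>" "\<delta> < 1" and L: "0 \<le> L"
    and \<alpha>_def: "\<alpha> = pair_alpha TYPE('d)"
  shows "path_prob N (\<lambda>xs. \<exists>n\<le>N. \<exists>z :: int ^ 'd. \<exists>e\<in>unit_steps.
      L < pair_rate \<alpha> (real (visits z (take n xs))) (real (visits (z + e) (take n xs))))
    \<le> real N * (2 * real CARD('d)) * (exp (- (1 - \<delta>) * L) / (\<alpha> * (1 - (2 * \<alpha>) powr \<delta>)\<^sup>2))"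
    (is "path_prob N ?E \<le> _ * _ * ?c")
proof -
  let ?P = "\<lambda>T e xs. \<exists>i\<le>T. L < pair_rate \<alpha> (real (Suc (visits 0 (take i xs)))) (real (visits e (take i xs)))"
  let ?I = "{1..N} \<times> (unit_steps :: (int ^ 'd) set)"
  have "path_prob N ?E \<le> path_prob N (\<lambda>xs. \<exists>p\<in>?I. ?P (N - fst p) (snd p) (drop (fst p) xs))"
  proof (rule path_prob_mono)
    fix xs :: "(int ^ 'd) list" assume xs: "length xs = N" "?E xs"
    then obtain n z e where n: "n \<le> N" and e: "e \<in> unit_steps" and
      gt: "L < pair_rate \<alpha> (real (visits z (take n xs))) (real (visits (z + e) (take n xs)))"
      by blast
    have ne: "z \<noteq> z + e" using unit_step_neq_0[OF e] by simp
    \<comment> \<open>Here \<open>a\<close> is the site visited first, which may be \<open>z\<close>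
      or \<open>z + e\<close>.\<close>
    have *: "\<exists>p\<in>?I. ?P (N - fst p) (snd p) (drop (fst p) xs)"
      if ab: "first_at a b (take n xs)" "a \<noteq> b" "b - a \<in> unit_steps"
        "L < pair_rate \<alpha> (real (visits a (take n xs))) (real (visits b (take n xs)))" for a b
    proof -
      obtain j where j: "0 < j" "j \<le> length (take n xs)"
        "visits a (take n xs) = Suc (visits 0 (drop j (take n xs)))"
        "visits b (take n xs) = visits (b - a) (drop j (take n xs))"
        using first_at_decompose[OF ab(1,2)] by blast
      have "?P (N - j) (b - a) (drop j xs)"
        using ab(4) j n xs(1) by (intro exI[of _ "n - j"]) (auto simp: drop_take)
      then show ?thesis using j n xs(1) ab(3) by (intro bexI[of _ "(j, b - a)"]) auto
    qed
    \<comment> \<open>An unvisited pair has rate 0, which does not exceed \<open>L\<close>.\<close>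
    have "visits z (take n xs) \<noteq> 0 \<or> visits (z + e) (take n xs) \<noteq> 0"
      using gt L by (cases "visits z (take n xs) = 0 \<and> visits (z + e) (take n xs) = 0") auto
    then have "first_at z (z + e) (take n xs) \<or> first_at (z + e) z (take n xs)"
      using visits_pair_eq_0_iff[of z "take n xs" "z + e"] by auto
    then show "\<exists>p\<in>?I. ?P (N - fst p) (snd p) (drop (fst p) xs)"
      using *[of z "z + e"] *[of "z + e" z] gt ne e by (auto simp: pair_rate_commute)
  qed
  also have "\<dots> \<le> (\<Sum>p\<in>?I. path_prob N (\<lambda>xs. ?P (N - fst p) (snd p) (drop (fst p) xs)))"
    by (rule path_prob_Bex) simp
  also have "\<dots> \<le> (\<Sum>p\<in>?I. ?c)"
  proof (rule sum_mono)
    fix p assume p: "p \<in> ?I"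
    have "path_prob (fst p + (N - fst p)) (\<lambda>xs. ?P (N - fst p) (snd p) (drop (fst p) xs))
        = path_prob (N - fst p) (?P (N - fst p) (snd p))"
      by (rule path_prob_drop)
    also have "\<dots> \<le> ?c"
      using p by (intro path_prob_rate_exceeds[OF d _ \<delta> \<alpha>_def]) auto
    finally show "path_prob N (\<lambda>xs. ?P (N - fst p) (snd p) (drop (fst p) xs)) \<le> ?c"
      using p by auto
  qed
  also have "\<dots> = real N * (2 * real CARD('d)) * ?c"
    by (simp add: card_cartesian_product card_unit_steps)
  finally show ?thesis .
qed

section \<open>Time reversal and isolated blocks of steps\<close>

text \<open>Both sides count the times, including 0, at which the walk is displaced by \<open>c\<close> from its endpoint.\<close>

lemma visits_rev:
  "visits (sum_list xs + c) xs + of_bool (sum_list xs + c = 0) = of_bool (c = 0) + visits (- c) (rev xs)"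
proof (induction xs)
  case (Cons x xs)
  have "x = - c - sum_list xs \<longleftrightarrow> sum_list (x # xs) + c = 0"
    by (auto simp: algebra_simps eq_neg_iff_add_eq_0)
  then show ?case
    using Cons.IH by (auto simp: visits_append algebra_simps of_bool_def)
qed simp

lemma visits_sum_list_pos: "xs \<noteq> [] \<Longrightarrow> 0 < visits (sum_list xs) xs"
  by (cases xs rule: rev_cases) (auto simp: visits_append)

text \<open>The time of interest lies \<open>w\<close> steps into the block, and the position at
  that time is the origin of both halves. In the reversed past a visit to the neighbour in direction
  \<open>e\<close> appears as a displacement by \<open>- e\<close>.\<close>

definition isolated_block :: "nat \<Rightarrow> int ^ 'd \<Rightarrow> nat \<Rightarrow> nat \<Rightarrow> (int ^ 'd) list \<Rightarrow> bool" where
  "isolated_block w e k l xs \<longleftrightarrow> (visits 0 (rev (take w xs)) = 0 \<and> visits (- e) (rev (take w xs)) = 0) \<and>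
    settled w 0 e k l (drop w xs)"

text \<open>These are visits to the pair at the position at time \<open>j\<close> that fall outside
  the window from j - w to j + T: in the past for the first two alternatives, in the future for the
  last two.\<close>

definition disturbed :: "nat \<Rightarrow> nat \<Rightarrow> int ^ 'd \<Rightarrow> nat \<Rightarrow> (int ^ 'd) list \<Rightarrow> bool" where
  "disturbed w T e j xs \<longleftrightarrow>
    (visits 0 (rev (take j xs)) \<noteq> visits 0 (take w (rev (take j xs))) \<or>
     visits (- e) (rev (take j xs)) \<noteq> visits (- e) (take w (rev (take j xs)))) \<or>
    (visits 0 (drop j xs) \<noteq> visits 0 (take T (drop j xs)) \<or>
     visits e (drop j xs) \<noteq> visits e (take T (drop j xs)))"

text \<open>The walk sits at \<open>z\<close> at a good time, and this visit is not among the \<open>k\<close> later ones: hence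
  \<open>Suc k\<close>.\<close>

definition pair_seen :: "nat \<Rightarrow> nat \<Rightarrow> int ^ 'd \<Rightarrow> nat \<Rightarrow> nat \<Rightarrow> (int ^ 'd) list \<Rightarrow> bool" where
  "pair_seen M N e k l xs \<longleftrightarrow> (\<exists>z. \<forall>n\<in>{M..N}.
    visits z (take n xs) = Suc k \<and> visits (z + e) (take n xs) = l)"

text \<open>Without disturbance the counts inside the window are the counts of the whole path, so
  they stay fixed from \<open>M\<close> to \<open>N\<close>. The witness is the position at time s +
  w.\<close>

lemma isolated_block_pair_seen:
  assumes e: "e \<in> unit_steps" and w: "0 < w" and N: "length xs = N" "s + (w + T) \<le> M" "M \<le> N"
    and block: "isolated_block w e k l (take (w + T) (drop s xs))"
    and undisturbed: "\<not> disturbed w T e (s + w) xs"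
  shows "pair_seen M N e k l xs"
proof -
  define us where "us = take (s + w) xs"
  define vs where "vs = drop (s + w) xs"
  have "length us = s + w" using N by (simp add: us_def)
  then have "us \<noteq> []" using w by auto
  have same: "visits 0 (rev us) = visits 0 (take w (rev us))"
    "visits (- e) (rev us) = visits (- e) (take w (rev us))"
    "visits 0 vs = visits 0 (take T vs)" "visits e vs = visits e (take T vs)"
    using undisturbed unfolding disturbed_def us_def vs_def by blast+
  have "take w (rev us) = rev (take w (take (w + T) (drop s xs)))"
    using N by (simp add: us_def take_add min_def)
  then have "visits 0 (rev us) = 0" "visits (- e) (rev us) = 0"
    using block same(1,2) unfolding isolated_block_def by simp_all
  \<comment> \<open>The extra terms count time 0. The endpoint of the nonempty list
    \<open>us\<close> is visited at least once after time 0, so the total of 1 excludes a visit at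
    time 0.\<close>
  then have "visits (sum_list us) us + of_bool (sum_list us = 0) = 1"
    "visits (sum_list us + e) us + of_bool (sum_list us + e = 0) = 0"
    using visits_rev[of us 0] visits_rev[of us e] unit_step_neq_0[OF e] by simp_all
  moreover have "0 < visits (sum_list us) us"
    using \<open>us \<noteq> []\<close> by (rule visits_sum_list_pos)
  ultimately have us: "visits (sum_list us) us = 1" "visits (sum_list us + e) us = 0"
    by linarith+
  have "drop w (take (w + T) (drop s xs)) = take T vs"
    by (simp add: vs_def drop_take add.commute)
  then have vs: "visits 0 (take T vs) = k" "visits e (take T vs) = l"
    "visits 0 vs = k" "visits e vs = l"
    using block same(3,4) unfolding isolated_block_def settled_def by simp_all
  have "visits (sum_list us) (take n xs) = Suc k \<and> visits (sum_list us + e) (take n xs) = l"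
    if n: "n \<in> {M..N}" for n
  proof -
    have "take n xs = us @ take (n - (s + w)) vs"
      using n N by (auto simp: us_def vs_def take_add[symmetric])
    moreover have "T \<le> n - (s + w)" using n N by auto
    then have "visits z (take T vs) \<le> visits z (take (n - (s + w)) vs)" for z
      using visits_take_le[of z T "take (n - (s + w)) vs"] by (simp add: min_absorb1)
    then have "visits 0 (take (n - (s + w)) vs) = k" "visits e (take (n - (s + w)) vs) = l"
      using visits_take_le[of _ "n - (s + w)" vs] vs by (metis antisym)+
    ultimately show ?thesis using us by (simp add: visits_append)
  qed
  then show ?thesis unfolding pair_seen_def by blast
qed

text \<open>The two halves of the block are independent. Each contributes a factor 1 - 2 \<alpha>:
  one for avoiding the pair in the reversed past, one for avoiding it after the last visit.\<close>

lemma path_prob_isolated_block_ge: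
  fixes e :: "int ^ 'd"
  assumes d: "4 \<le> CARD('d)" and e: "e \<in> unit_steps" and w: "0 < w"
    and \<alpha>: "\<alpha> = pair_alpha TYPE('d)"
    and \<beta>: "\<beta> = \<alpha> - 23 / sqrt (real w)" "0 \<le> \<beta>"
    and T: "(k + l) * w + w \<le> T"
  shows "(1 - 2 * \<alpha>)\<^sup>2 * pair_weight \<beta> k l \<le> path_prob (w + T) (isolated_block w e k l)"
proof -
  have op: "origin_pair 0 e" "origin_pair 0 (- e)" using e by (simp_all add: origin_pair_def)
  have "path_prob (w + T) (isolated_block w e k l) =
      path_prob w (\<lambda>xs. visits 0 xs = 0 \<and> visits (- e) xs = 0) * path_prob T (settled w 0 e k l)"
    unfolding isolated_block_def
    using path_prob_take_drop[of w T "\<lambda>xs. visits 0 (rev xs) = 0 \<and> visits (- e) (rev xs) = 0" "settled w 0 e k l"]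
      path_prob_rev[of w "\<lambda>xs. visits 0 xs = 0 \<and> visits (- e) xs = 0"] by simp
  moreover have "(1 - 2 * \<alpha>) * ((1 - 2 * \<alpha>) * pair_weight \<beta> k l) \<le> \<dots>"
    using path_prob_no_visit_ge[OF d op(2), of w] path_prob_settled_ge[OF d op(1) w \<beta>[unfolded \<alpha>] T]
      pair_alpha_bounds[OF d] pair_weight_nonneg[OF \<beta>(2)] \<alpha>
    by (intro mult_mono) (auto simp: path_prob_nonneg)
  ultimately show ?thesis by (simp add: power2_eq_square mult.assoc)
qed

lemma path_prob_all_blocks:
  "path_prob (K * B + R) (\<lambda>xs. \<forall>b<K. \<not> Q (take B (drop (b * B) xs))) = (1 - path_prob B Q) ^ K"
proof (induction K)
  case (Suc K)
  have "path_prob (Suc K * B + R) (\<lambda>xs. \<forall>b<Suc K. \<not> Q (take B (drop (b * B) xs)))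
    = path_prob (B + (K * B + R)) (\<lambda>xs. \<not> Q (take B xs) \<and> (\<forall>b<K. \<not> Q (take B (drop (b * B) (drop B xs)))))"
    by (simp add: All_less_Suc2 add_ac)
  also have "\<dots> = (1 - path_prob B Q) * (1 - path_prob B Q) ^ K"
    using path_prob_take_drop[of B "K * B + R" "\<lambda>ys. \<not> Q ys" "\<lambda>xs. \<forall>b<K. \<not> Q (take B (drop (b * B) xs))"]
    by (simp only: path_prob_not Suc.IH)
  finally show ?case by simp
qed simp

lemma path_prob_late_visit_le:
  fixes a :: "int ^ 'd"
  assumes "4 \<le> CARD('d)" "0 < w"
  shows "path_prob (w + m) (\<lambda>xs. visits a xs \<noteq> visits a (take w xs)) \<le> 23 / sqrt (real w)"
  using path_prob_late_visit[OF assms(1), of w m a] potential_le[OF assms(2), of a] by simp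

text \<open>Each of the four kinds of disturbance costs 23 / sqrt w on top of the weight. A past one
  is independent of the second half of the block. For a future one the counts are attained
  \<open>w\<close> steps before the end of the block, so the later return is a late visit,
  conditionally on those steps.\<close>

lemma path_prob_isolated_and_disturbed_le:
  fixes e :: "int ^ 'd"
  assumes d: "4 \<le> CARD('d)" and e: "e \<in> unit_steps" and w: "0 < w" "w \<le> T"
    and \<alpha>: "\<alpha> = pair_alpha TYPE('d)" and N: "s + (w + T) \<le> N"
  shows "path_prob N (\<lambda>xs. isolated_block w e k l (take (w + T) (drop s xs)) \<and> disturbed w T e (s + w) xs)
    \<le> 92 / sqrt (real w) * pair_weight \<alpha> k l"
proof -
  obtain m where m: "N = s + (w + T) + m" using N by (metis le_Suc_ex)
  let ?j = "s + w" and ?c = "23 / sqrt (real w)"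
  \<comment> \<open>Of the good block only \<open>?Q\<close> is retained; it depends just on the T -
    w steps that follow time \<open>?j\<close>.\<close>
  let ?Q = "\<lambda>xs. passes 0 e k l (take (T - w) xs)"
  have pass: "path_prob T' (passes 0 e k l) \<le> pair_weight \<alpha> k l" for T'
    unfolding \<alpha> using e by (intro path_prob_passes_le[OF d]) (simp add: origin_pair_def)
  have past: "path_prob N (\<lambda>xs. ?Q (drop ?j xs) \<and>
      visits a (rev (take ?j xs)) \<noteq> visits a (take w (rev (take ?j xs)))) \<le> ?c * pair_weight \<alpha> k l" for a
  proof -
    have "path_prob (?j + (T + m)) (\<lambda>xs. visits a (rev (take ?j xs)) \<noteq> visits a (take w (rev (take ?j xs))) \<and> ?Q (drop ?j xs))
      = path_prob ?j (\<lambda>xs. visits a (rev xs) \<noteq> visits a (take w (rev xs))) * path_prob (T + m) ?Q"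
      by (rule path_prob_take_drop)
    also have "path_prob ?j (\<lambda>xs. visits a (rev xs) \<noteq> visits a (take w (rev xs)))
      = path_prob (w + s) (\<lambda>xs. visits a xs \<noteq> visits a (take w xs))"
      using path_prob_rev[of ?j "\<lambda>xs. visits a xs \<noteq> visits a (take w xs)"] by (simp add: add.commute)
    also have "path_prob (T + m) ?Q = path_prob (T - w) (passes 0 e k l)"
      using path_prob_take[of "T - w" "w + m" "passes 0 e k l"] w by simp
    also have "path_prob (w + s) (\<lambda>xs. visits a xs \<noteq> visits a (take w xs)) * path_prob (T - w) (passes 0 e k l)
      \<le> ?c * pair_weight \<alpha> k l"
      using path_prob_late_visit_le[OF d w(1)] pass by (intro mult_mono) (auto simp: path_prob_nonneg)
    finally show ?thesis by (simp add: m conj_commute add.assoc)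
  qed
  have future: "path_prob N (\<lambda>xs. ?Q (drop ?j xs) \<and>
      visits a (drop ?j xs) \<noteq> visits a (take T (drop ?j xs))) \<le> ?c * pair_weight \<alpha> k l" for a
  proof -
    have "path_prob (?j + (T + m)) (\<lambda>xs. ?Q (drop ?j xs) \<and> visits a (drop ?j xs) \<noteq> visits a (take T (drop ?j xs)))
      = path_prob (T + m) (\<lambda>xs. ?Q xs \<and> visits a xs \<noteq> visits a (take T xs))"
      by (rule path_prob_drop)
    \<comment> \<open>Seen from time ?j + (T - w), a visit after ?j + T comes more than
      \<open>w\<close> steps later.\<close>
    also have split: "T + m = (T - w) + (w + m)" using w by simp
    also have "path_prob ((T - w) + (w + m)) (\<lambda>xs. ?Q xs \<and> visits a xs \<noteq> visits a (take T xs))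
      \<le> path_prob (T - w) (passes 0 e k l) * ?c"
    proof (rule path_prob_append_le)
      fix xs :: "(int ^ 'd) list" assume xs: "length xs = T - w"
      have "path_prob (w + m) (\<lambda>ys. visits a (xs @ ys) \<noteq> visits a (take T (xs @ ys)))
        = path_prob (w + m) (\<lambda>ys. visits (a - sum_list xs) ys \<noteq> visits (a - sum_list xs) (take w ys))"
        using xs w by (intro path_prob_cong) (auto simp: visits_append)
      also have "\<dots> \<le> ?c" by (rule path_prob_late_visit_le[OF d w(1)])
      finally show "path_prob (w + m) (\<lambda>ys. visits a (xs @ ys) \<noteq> visits a (take T (xs @ ys))) \<le> ?c" .
    qed
    also have "\<dots> \<le> pair_weight \<alpha> k l * ?c" using pass by (intro mult_right_mono) auto
    finally show ?thesis by (simp add: m mult.commute add.assoc flip: split)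
  qed
  have "path_prob N (\<lambda>xs. isolated_block w e k l (take (w + T) (drop s xs)) \<and> disturbed w T e ?j xs)
    \<le> path_prob N (\<lambda>xs.
      (?Q (drop ?j xs) \<and> visits 0 (rev (take ?j xs)) \<noteq> visits 0 (take w (rev (take ?j xs))) \<or>
       ?Q (drop ?j xs) \<and> visits (- e) (rev (take ?j xs)) \<noteq> visits (- e) (take w (rev (take ?j xs)))) \<or>
      (?Q (drop ?j xs) \<and> visits 0 (drop ?j xs) \<noteq> visits 0 (take T (drop ?j xs)) \<or>
       ?Q (drop ?j xs) \<and> visits e (drop ?j xs) \<noteq> visits e (take T (drop ?j xs))))"
  proof (rule path_prob_mono)
    fix xs :: "(int ^ 'd) list" assume xs: "length xs = N"
      "isolated_block w e k l (take (w + T) (drop s xs)) \<and> disturbed w T e ?j xs"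
    have "drop w (take (w + T) (drop s xs)) = take T (drop ?j xs)"
      by (simp add: drop_take add.commute)
    then have "settled w 0 e k l (take T (drop ?j xs))"
      using xs(2) by (simp add: isolated_block_def)
    from settled_imp_passes[OF this] have "?Q (drop ?j xs)"
      using xs(1) m by (simp add: min_def split: if_splits)
    then show "(?Q (drop ?j xs) \<and> visits 0 (rev (take ?j xs)) \<noteq> visits 0 (take w (rev (take ?j xs))) \<or>
       ?Q (drop ?j xs) \<and> visits (- e) (rev (take ?j xs)) \<noteq> visits (- e) (take w (rev (take ?j xs)))) \<or>
      (?Q (drop ?j xs) \<and> visits 0 (drop ?j xs) \<noteq> visits 0 (take T (drop ?j xs)) \<or>
       ?Q (drop ?j xs) \<and> visits e (drop ?j xs) \<noteq> visits e (take T (drop ?j xs)))"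
      using xs(2) unfolding disturbed_def by blast
  qed
  also have "\<dots> \<le> (?c * pair_weight \<alpha> k l + ?c * pair_weight \<alpha> k l) + (?c * pair_weight \<alpha> k l + ?c * pair_weight \<alpha> k l)"
    by (intro order_trans[OF path_prob_disj] add_mono past future)
  also have "\<dots> = 92 / sqrt (real w) * pair_weight \<alpha> k l" by simp
  finally show ?thesis .
qed

text \<open>If the pair is unseen, either none of the \<open>K\<close> disjoint blocks is isolated,
  or some isolated block is disturbed. Independence handles the first case, a union bound the
  second.\<close>

lemma path_prob_pair_unseen_le:
  fixes e :: "int ^ 'd"
  assumes d: "4 \<le> CARD('d)" and e: "e \<in> unit_steps" and w: "0 < w" "w \<le> T"
    and \<alpha>: "\<alpha> = pair_alpha TYPE('d)" and M: "K * (w + T) \<le> M" "M \<le> N"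
  shows "path_prob N (\<lambda>xs. \<not> pair_seen M N e k l xs) \<le>
    (1 - path_prob (w + T) (isolated_block w e k l)) ^ K + real K * (92 / sqrt (real w) * pair_weight \<alpha> k l)"
proof -
  let ?B = "w + T"
  let ?Q = "isolated_block w e k l"
  obtain R where R: "N = K * ?B + R" using M by (metis le_Suc_ex le_trans)
  have fit: "b * ?B + ?B \<le> M" if "b < K" for b
    using mult_le_mono1[of "Suc b" K ?B] that M by simp
  have "path_prob N (\<lambda>xs. \<not> pair_seen M N e k l xs) \<le> path_prob N (\<lambda>xs.
      (\<forall>b<K. \<not> ?Q (take ?B (drop (b * ?B) xs))) \<or>
      (\<exists>b\<in>{..<K}. ?Q (take ?B (drop (b * ?B) xs)) \<and> disturbed w T e (b * ?B + w) xs))"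
  proof (rule path_prob_mono)
    fix xs :: "(int ^ 'd) list" assume "length xs = N" "\<not> pair_seen M N e k l xs"
    then show "(\<forall>b<K. \<not> ?Q (take ?B (drop (b * ?B) xs))) \<or>
      (\<exists>b\<in>{..<K}. ?Q (take ?B (drop (b * ?B) xs)) \<and> disturbed w T e (b * ?B + w) xs)"
      using isolated_block_pair_seen[OF e w(1), of xs N _ T M k l] fit M(2) by blast
  qed
  also have "\<dots> \<le> path_prob N (\<lambda>xs. \<forall>b<K. \<not> ?Q (take ?B (drop (b * ?B) xs))) +
      path_prob N (\<lambda>xs. \<exists>b\<in>{..<K}. ?Q (take ?B (drop (b * ?B) xs)) \<and> disturbed w T e (b * ?B + w) xs)"
    by (rule path_prob_disj)
  also have "\<dots> \<le> (1 - path_prob ?B ?Q) ^ K +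
      (\<Sum>b\<in>{..<K}. path_prob N (\<lambda>xs. ?Q (take ?B (drop (b * ?B) xs)) \<and> disturbed w T e (b * ?B + w) xs))"
    unfolding R path_prob_all_blocks by (intro add_left_mono path_prob_Bex) simp
  also have "\<dots> \<le> (1 - path_prob ?B ?Q) ^ K + (\<Sum>b\<in>{..<K}. 92 / sqrt (real w) * pair_weight \<alpha> k l)"
    using fit M(2)
    by (intro add_left_mono sum_mono path_prob_isolated_and_disturbed_le[OF d e w \<alpha>])
      (meson lessThan_iff le_trans)
  also have "\<dots> = (1 - path_prob ?B ?Q) ^ K + real K * (92 / sqrt (real w) * pair_weight \<alpha> k l)"
    by simp
  finally show ?thesis .
qed

section \<open>Summable bounds along powers of two\<close>

text \<open>With about m / u blocks the expected number of good blocks is of order m, so having none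
  is exponentially unlikely in m, while disturbances cost O(m / s). The condition on
  \<open>s\<close> limits the loss from \<alpha> to \<beta> to a factor 2 in the weight; the
  condition on \<open>M\<close> makes room for the blocks.\<close>

lemma path_prob_pair_unseen_exp_le:
  fixes e :: "int ^ 'd"
  assumes d: "4 \<le> CARD('d)" and e: "e \<in> unit_steps" and \<alpha>: "\<alpha> = pair_alpha TYPE('d)"
    and u: "u = pair_weight \<alpha> k l"
    and y: "real (k + l) \<le> y" "1 \<le> y"
    and s: "s = sqrt (real w)" "46 * y \<le> \<alpha> * s"
    and M: "(real m / u + 1) * ((y + 2) * real w) \<le> real M" "M \<le> N"
  shows "path_prob N (\<lambda>xs. \<not> pair_seen M N e k l xs) \<le>
    exp (- ((1 - 2 * \<alpha>)\<^sup>2 / 2) * real m) + 92 * (real m + 1) / s"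
proof -
  have \<alpha>0: "0 < \<alpha>" "\<alpha> < 1 / 2" using pair_alpha_bounds[OF d] \<alpha> by auto
  have "0 < \<alpha> * s" using s(2) y(2) by linarith
  then have s0: "0 < s" using \<alpha>0 by (simp add: zero_less_mult_iff)
  then have w: "0 < w" using s(1) by (cases w) auto
  have u0: "0 < u" using \<alpha>0 by (simp add: u pair_weight_def)
  have "0 \<le> pair_rate \<alpha> (real k) (real l)"
    using pair_rate_ge[of "real k" "real l" \<alpha>] mult_nonneg_nonneg[of "real k + real l" "- ln (2 * \<alpha>)"] \<alpha>0
    by auto
  then have u1: "u \<le> 1"
    using order_trans[OF pair_weight_le[OF \<alpha>0(1)], of k l 1] by (simp add: u)
  \<comment> \<open>A stretch of \<open>w\<close> steps for each visit, and one for the quiet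
    end.\<close>
  define T where "T = (k + l) * w + w"
  define K where "K = nat \<lceil>real m / u\<rceil>"
  define \<beta> where "\<beta> = \<alpha> - 23 / s"
  have K: "real m / u \<le> real K" "real K \<le> real m / u + 1"
    using u0 by (auto simp: K_def)
  have x: "23 / (\<alpha> * s) \<le> 1" "real (k + l) * (23 / (\<alpha> * s)) \<le> 1 / 2"
    using s y \<alpha>0 s0 by (auto simp: divide_le_eq)
  have \<beta>: "\<beta> = \<alpha> * (1 + - (23 / (\<alpha> * s)))"
    using \<alpha>0 s0 by (simp add: \<beta>_def field_simps)
  have \<beta>0: "0 \<le> \<beta>" unfolding \<beta> using x \<alpha>0 by simp
  \<comment> \<open>Bernoulli's inequality bounds (\<beta> / \<alpha>)^(k + l) below by 1/2.\<close>
  have "1 / 2 \<le> 1 + real (k + l) * - (23 / (\<alpha> * s))" using x(2) by simp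
  also have "\<dots> \<le> (1 + - (23 / (\<alpha> * s))) ^ (k + l)"
    using x(1) by (intro Bernoulli_inequality) auto
  finally have "\<alpha> ^ (k + l) * (1 / 2) \<le> \<alpha> ^ (k + l) * (1 + - (23 / (\<alpha> * s))) ^ (k + l)"
    using \<alpha>0 by (intro mult_left_mono) auto
  then have "u / 2 \<le> pair_weight \<beta> k l"
    by (simp add: u pair_weight_def \<beta> power_mult_distrib mult_left_mono)
  then have "(1 - 2 * \<alpha>)\<^sup>2 * (u / 2) \<le> (1 - 2 * \<alpha>)\<^sup>2 * pair_weight \<beta> k l"
    by (intro mult_left_mono) auto
  also have "\<dots> \<le> path_prob (w + T) (isolated_block w e k l)"
    by (rule path_prob_isolated_block_ge[OF d e w \<alpha> _ \<beta>0]) (simp_all add: \<beta>_def s T_def)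
  finally have p: "(1 - 2 * \<alpha>)\<^sup>2 * (u / 2) \<le> path_prob (w + T) (isolated_block w e k l)"
    (is "_ \<le> ?p") .
  have "real K * real (w + T) \<le> (real m / u + 1) * ((y + 2) * real w)"
  proof (intro mult_mono K(2))
    show "real (w + T) \<le> (y + 2) * real w"
    proof -
      have "real (w + T) = (real (k + l) + 2) * real w" by (simp add: T_def algebra_simps)
      also have "\<dots> \<le> (y + 2) * real w" using y(1) by (intro mult_right_mono) auto
      finally show ?thesis .
    qed
  qed (use u0 in auto)
  then have KB: "K * (w + T) \<le> M"
    using M(1) by (metis of_nat_mult of_nat_le_iff order_trans)
  have "(1 - ?p) ^ K \<le> exp (- ?p) ^ K"
    using path_prob_le_1[of "w + T"] exp_ge_add_one_self[of "- ?p"] by (intro power_mono) auto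
  also have "\<dots> = exp (- (real K * ?p))" by (simp add: exp_of_nat_mult[symmetric])
  also have "\<dots> \<le> exp (- ((1 - 2 * \<alpha>)\<^sup>2 / 2) * real m)"
  proof -
    have "(1 - 2 * \<alpha>)\<^sup>2 / 2 * real m = real m / u * ((1 - 2 * \<alpha>)\<^sup>2 * (u / 2))"
      using u0 by (simp add: field_simps)
    also have "\<dots> \<le> real K * ?p" using K(1) p u0 by (intro mult_mono) auto
    finally show ?thesis by simp
  qed
  finally have 1: "(1 - ?p) ^ K \<le> exp (- ((1 - 2 * \<alpha>)\<^sup>2 / 2) * real m)" .
  have "real K * u \<le> (real m / u + 1) * u" using K(2) u0 by (intro mult_right_mono) auto
  also have "\<dots> \<le> real m + 1" using u0 u1 by (simp add: field_simps)
  finally have "92 / s * (real K * u) \<le> 92 / s * (real m + 1)" using s0 by (intro mult_left_mono) auto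
  then have 2: "real K * (92 / s * u) \<le> 92 * (real m + 1) / s" by (simp add: mult_ac)
  show ?thesis
    using path_prob_pair_unseen_le[OF d e w _ \<alpha> KB M(2), of k l] 1 2
    by (simp add: T_def s(1) u)
qed

text \<open>The window grows like 2^(\<epsilon> m / 2): fast enough for the errors 1 / sqrt w to be
  summable, slowly enough for 2^((1 - \<epsilon>) m) blocks, up to polynomial factors, to fit into
  2^m steps. The number of admissible (k, l) is polynomial in m.\<close>

lemma summable_path_prob_pair_unseen:
  assumes d: "4 \<le> CARD('d)" and \<alpha>: "\<alpha> = pair_alpha TYPE('d)" and \<epsilon>: "0 < \<epsilon>" "\<epsilon> < 1"
  shows "summable (\<lambda>m. path_prob (2 ^ Suc m) (\<lambda>xs. \<exists>e\<in>unit_steps :: (int ^ 'd) set. \<exists>k l.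
    pair_rate \<alpha> (real k) (real l) \<le> (1 - \<epsilon>) * ln (2 ^ Suc m) \<and>
    \<not> pair_seen (2 ^ m) (2 ^ Suc m) e k l xs))" (is "summable (\<lambda>m. path_prob _ (?E m))")
proof -
  have \<alpha>0: "0 < \<alpha>" "2 * \<alpha> < 1" using pair_alpha_bounds[OF d] \<alpha> by auto
  define c where "c = (1 - \<epsilon>) * ln 2 / - ln (2 * \<alpha>)"
  have ln\<alpha>: "0 < - ln (2 * \<alpha>)" using \<alpha>0 by simp
  have c: "0 < c" unfolding c_def using ln\<alpha> \<epsilon> by (intro divide_pos_pos mult_pos_pos) auto
  define c' where "c' = (1 - 2 * \<alpha>)\<^sup>2 / 2"
  have c': "0 < c'" using \<alpha>0 by (simp add: c'_def)
  \<comment> \<open>\<open>y\<close> will bound k + l through \<open>pair_rate_ge\<close>,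
    \<open>V\<close> will bound 1 / \<open>pair_weight\<close> through
    \<open>pair_weight_ge\<close>, and \<open>v\<close> is the window length before rounding. The
    last summand of \<open>y\<close> ensures \<open>1 \<le> y m\<close>.\<close>
  define y where "y m = c * (real m + 1) + 1" for m
  define V where "V m = 3 * (y m + 1)\<^sup>2 * exp ((1 - \<epsilon>) * ((real m + 1) * ln 2))" for m
  define v where "v m = 2 powr (\<epsilon> / 2 * real m)" for m
  define w where "w m = nat \<lceil>v m\<rceil>" for m
  have v0: "0 < v m" for m by (simp add: v_def)
  have w: "v m \<le> real (w m)" "real (w m) \<le> v m + 1" for m
    using v0[of m] by (auto simp: w_def)
  define q where "q m = exp (- c' * real m) + 92 * (real m + 1) / sqrt (v m)" for m
  have "eventually (\<lambda>m. 46 * y m \<le> \<alpha> * sqrt (v m)) at_top"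
    unfolding y_def v_def using \<alpha>0 c \<epsilon> by real_asymp
  moreover have "eventually (\<lambda>m. (real m * V m + 1) * ((y m + 2) * (v m + 1)) \<le> 2 ^ m) at_top"
  proof -
    define A where "A = 3 * exp ((1 - \<epsilon>) * ln 2)"
    \<comment> \<open>\<open>t\<close> is 1 / \<open>v\<close>. Factoring the exponentials exactly,
      through 2^m t^2 = 2^((1 - \<epsilon>) m), leaves only a polynomial times \<open>t\<close> to
      be estimated.\<close>
    define t where "t m = 2 powr (- (\<epsilon> / 2) * real m)" for m
    have "0 < A" by (simp add: A_def)
    then have "eventually (\<lambda>m. (real m * ((y m + 1)\<^sup>2 * A) + 1) * ((y m + 2) * 2) * t m \<le> 1) at_top"
      unfolding t_def y_def using c \<epsilon> by real_asymp
    then show ?thesis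
    proof eventually_elim
      case (elim m)
      have t: "0 < t m" "t m * v m = 1" by (simp_all add: t_def v_def powr_add[symmetric])
      have "t m * t m = exp (- (\<epsilon> * real m * ln 2))"
        by (simp add: t_def powr_def exp_add[symmetric])
      moreover have pow2: "2 ^ m = exp (real m * ln 2 :: real)" by (simp add: exp_of_nat_mult)
      ultimately have "2 ^ m * (t m * t m) = exp ((1 - \<epsilon>) * (real m * ln 2))"
        by (simp add: exp_add[symmetric] algebra_simps)
      then have V: "V m = (y m + 1)\<^sup>2 * A * (2 ^ m * (t m * t m))"
        by (simp add: V_def A_def exp_add[symmetric] algebra_simps)
      have one: "1 \<le> 2 ^ m * (t m * t m)"
        unfolding \<open>2 ^ m * (t m * t m) = _\<close> using \<epsilon> by simp
      have "1 \<le> v m" unfolding v_def using \<epsilon> by (intro ge_one_powr_ge_zero) auto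
      moreover have "0 \<le> y m" using c by (simp add: y_def)
      ultimately have "(real m * V m + 1) * ((y m + 2) * (v m + 1))
          \<le> (real m * V m + 2 ^ m * (t m * t m)) * ((y m + 2) * (v m + v m))"
        using one by (intro mult_mono add_mono) (auto simp: V \<open>0 < A\<close> less_imp_le)
      also have "\<dots> = 2 ^ m * ((real m * ((y m + 1)\<^sup>2 * A) + 1) * ((y m + 2) * 2) * t m * (t m * v m))"
        by (simp add: V algebra_simps)
      also have "\<dots> \<le> 2 ^ m * 1" using elim t(2) by (intro mult_left_mono) auto
      finally show ?case by simp
    qed
  qed
  ultimately have "eventually (\<lambda>m. path_prob (2 ^ Suc m) (?E m) \<le> (y m + 1)\<^sup>2 * (2 * real CARD('d)) * q m) at_top"
  proof eventually_elim
    case (elim m)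
    have y1: "1 \<le> y m" using c by (simp add: y_def)
    let ?I = "(unit_steps :: (int ^ 'd) set) \<times> {..nat \<lfloor>y m\<rfloor>} \<times> {..nat \<lfloor>y m\<rfloor>}"
    let ?R = "\<lambda>k l. pair_rate \<alpha> (real k) (real l) \<le> (1 - \<epsilon>) * ln (2 ^ Suc m)"
    let ?P = "\<lambda>(e, k, l) xs. ?R k l \<and> \<not> pair_seen (2 ^ m) (2 ^ Suc m) e k l xs"
    have ln2: "ln (2 ^ Suc m) = (real m + 1) * ln (2::real)"
      using ln_realpow[of "2::real" "Suc m"] by (simp add: algebra_simps del: power_Suc)
    have kl: "real (k + l) \<le> y m" if "?R k l" for k l
    proof -
      have "real (k + l) * - ln (2 * \<alpha>) \<le> (1 - \<epsilon>) * ((real m + 1) * ln 2)"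
        using pair_rate_ge[of "real k" "real l" \<alpha>] \<alpha>0 that by (simp only: ln2) simp
      then have "real (k + l) \<le> (1 - \<epsilon>) * ((real m + 1) * ln 2) / - ln (2 * \<alpha>)"
        using ln\<alpha> by (simp only: pos_le_divide_eq)
      then show ?thesis by (simp add: y_def c_def mult_ac)
    qed
    have "path_prob (2 ^ Suc m) (?E m) \<le> path_prob (2 ^ Suc m) (\<lambda>xs. \<exists>p\<in>?I. ?P p xs)"
    proof (rule path_prob_mono)
      fix xs assume "?E m xs"
      then obtain e k l where ekl: "e \<in> unit_steps" "?R k l" "\<not> pair_seen (2 ^ m) (2 ^ Suc m) e k l xs"
        by blast
      have "k \<le> nat \<lfloor>y m\<rfloor>" "l \<le> nat \<lfloor>y m\<rfloor>"
        using kl[OF ekl(2)] by (auto simp: le_nat_iff le_floor_iff)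
      then show "\<exists>p\<in>?I. ?P p xs" using ekl by (intro bexI[of _ "(e, k, l)"]) auto
    qed
    also have "\<dots> \<le> (\<Sum>p\<in>?I. path_prob (2 ^ Suc m) (?P p))"
      by (rule path_prob_Bex) simp
    also have "\<dots> \<le> (\<Sum>p\<in>?I. q m)"
    proof (rule sum_mono)
      fix p assume p: "p \<in> ?I"
      obtain e k l where p_eq: "p = (e, k, l)" by (cases p)
      show "path_prob (2 ^ Suc m) (?P p) \<le> q m"
      proof (cases "?R k l")
        case True
        define u where "u = pair_weight \<alpha> k l"
        have u0: "0 < u" using \<alpha>0 by (simp add: u_def pair_weight_def)
        define E where "E = exp ((1 - \<epsilon>) * ((real m + 1) * ln 2))"
        have E: "0 < E" by (simp add: E_def)
        have "exp (- ((1 - \<epsilon>) * ((real m + 1) * ln 2))) \<le> exp (- pair_rate \<alpha> (real k) (real l))"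
          using True by (simp only: ln2) simp
        also have "\<dots> \<le> 3 * real (k + 1) * real (l + 1) * u"
          unfolding u_def by (rule pair_weight_ge[OF \<alpha>0(1)])
        also have "\<dots> \<le> 3 * (y m + 1) * (y m + 1) * u"
          using kl[OF True] u0 by (intro mult_right_mono mult_mono) auto
        finally have "1 / E \<le> 3 * (y m + 1) * (y m + 1) * u"
          by (simp only: E_def exp_minus inverse_eq_divide)
        then have "1 / u \<le> V m"
          using u0 E by (simp add: V_def flip: E_def) (simp add: field_simps power2_eq_square)
        then have mu: "real m / u \<le> real m * V m"
          using mult_left_mono[of "1 / u" "V m" "real m"] by simp
        have "path_prob (2 ^ Suc m) (?P p) = path_prob (2 ^ Suc m) (\<lambda>xs. \<not> pair_seen (2 ^ m) (2 ^ Suc m) e k l xs)"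
          using True p_eq by (intro path_prob_cong) auto
        also have "\<dots> \<le> exp (- ((1 - 2 * \<alpha>)\<^sup>2 / 2) * real m) + 92 * (real m + 1) / sqrt (real (w m))"
        proof (rule path_prob_pair_unseen_exp_le[OF d _ \<alpha> u_def kl[OF True] y1 refl])
          show "e \<in> unit_steps" using p p_eq by auto
          have "sqrt (v m) \<le> sqrt (real (w m))" using w by simp
          then have "\<alpha> * sqrt (v m) \<le> \<alpha> * sqrt (real (w m))" using \<alpha>0 by (intro mult_left_mono) auto
          then show "46 * y m \<le> \<alpha> * sqrt (real (w m))" using elim(1) by linarith
          have "(real m / u + 1) * ((y m + 2) * real (w m)) \<le> (real m * V m + 1) * ((y m + 2) * (v m + 1))"
            using mu w y1 u0 by (intro mult_mono) (auto intro!: add_nonneg_nonneg order_trans[OF _ mu])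
          also have "\<dots> \<le> real (2 ^ m)" using elim(2) by simp
          finally show "(real m / u + 1) * ((y m + 2) * real (w m)) \<le> real (2 ^ m)" .
        qed simp
        also have "\<dots> \<le> q m"
          unfolding q_def c'_def using w[of m] v0[of m]
          by (intro add_left_mono divide_left_mono mult_pos_pos) auto
        finally show ?thesis .
      next
        case False
        then have "path_prob (2 ^ Suc m) (?P p) = 0" using p_eq by simp
        also have "0 \<le> q m" using v0[of m] by (simp add: q_def add_nonneg_nonneg)
        finally show ?thesis .
      qed
    qed
    also have "\<dots> = (real (Suc (nat \<lfloor>y m\<rfloor>)))\<^sup>2 * (2 * real CARD('d)) * q m"
      by (simp add: card_cartesian_product card_unit_steps power2_eq_square algebra_simps)
    also have "\<dots> \<le> (y m + 1)\<^sup>2 * (2 * real CARD('d)) * q m"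
      using y1 v0[of m] by (intro mult_right_mono power_mono) (auto simp: q_def add_nonneg_nonneg)
    finally show ?case .
  qed
  then have "eventually (\<lambda>m. norm (path_prob (2 ^ Suc m) (?E m)) \<le> (y m + 1)\<^sup>2 * (2 * real CARD('d)) * q m) at_top"
    by eventually_elim (simp add: path_prob_nonneg)
  moreover have "summable (\<lambda>m. (y m + 1)\<^sup>2 * (2 * real CARD('d)) * q m)"
  proof (rule summable_comparison_test_bigo)
    show "summable (\<lambda>m. norm (1 / real m ^ 2))"
      using inverse_power_summable[of 2, where 'a = real] by (simp add: inverse_eq_divide)
    have "(\<lambda>m. (y m + 1)\<^sup>2 * exp (- c' * real m)) \<in> O(\<lambda>m. 1 / real m ^ 2)"
      unfolding y_def using c c' by real_asymp
    moreover have "(\<lambda>m. (y m + 1)\<^sup>2 * (92 * (real m + 1) / sqrt (v m))) \<in> O(\<lambda>m. 1 / real m ^ 2)"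
      unfolding y_def v_def using c \<epsilon> by real_asymp
    ultimately have "(\<lambda>m. (y m + 1)\<^sup>2 * q m) \<in> O(\<lambda>m. 1 / real m ^ 2)"
      unfolding q_def distrib_left by (rule sum_in_bigo)
    then have "(\<lambda>m. (2 * real CARD('d)) * ((y m + 1)\<^sup>2 * q m)) \<in> O(\<lambda>m. 1 / real m ^ 2)"
      by simp
    then show "(\<lambda>m. (y m + 1)\<^sup>2 * (2 * real CARD('d)) * q m) \<in> O(\<lambda>m. 1 / real m ^ 2)"
      by (simp only: mult_ac)
  qed
  ultimately show ?thesis by (rule summable_comparison_test_ev)
qed

text \<open>The level belongs to 2^m and the paths have length 2^(m + 1), so that one event serves
  all times in between. The factor 2^(m + 1) of the union bound is beaten by 2^(- (1 + \<epsilon> /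
  2) m).\<close>

lemma summable_path_prob_rate_exceeds:
  assumes d: "4 \<le> CARD('d)" and \<alpha>: "\<alpha> = pair_alpha TYPE('d)" and \<epsilon>: "0 < \<epsilon>"
  shows "summable (\<lambda>m. path_prob (2 ^ Suc m) (\<lambda>xs. \<exists>n\<le>2 ^ Suc m. \<exists>z :: int ^ 'd. \<exists>e\<in>unit_steps.
    (1 + \<epsilon>) * ln (2 ^ m) < pair_rate \<alpha> (real (visits z (take n xs))) (real (visits (z + e) (take n xs)))))"
    (is "summable (\<lambda>m. path_prob _ (?E m))")
proof -
  \<comment> \<open>Chosen so that (1 - \<delta>) (1 + \<epsilon>) = 1 + \<epsilon> / 2.\<close>
  define \<delta> where "\<delta> = \<epsilon> / (2 * (1 + \<epsilon>))"
  have \<delta>: "0 < \<delta>" "\<delta> < 1" using \<epsilon> by (auto simp: \<delta>_def)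
  define C where "C = 4 * real CARD('d) / (\<alpha> * (1 - (2 * \<alpha>) powr \<delta>)\<^sup>2)"
  have "path_prob (2 ^ Suc m) (?E m) \<le> C * (2 powr (- \<epsilon> / 2)) ^ m" for m
  proof -
    have "(1 - \<delta>) * (1 + \<epsilon>) = 1 + \<epsilon> / 2" using \<epsilon> by (simp add: \<delta>_def field_simps)
    moreover have "- (1 - \<delta>) * ((1 + \<epsilon>) * ln (2 ^ m)) = - ((1 - \<delta>) * (1 + \<epsilon>)) * (real m * ln 2)"
      by (simp add: ln_realpow algebra_simps)
    ultimately have "- (1 - \<delta>) * ((1 + \<epsilon>) * ln (2 ^ m)) = - (1 + \<epsilon> / 2) * (real m * ln 2)"
      by (simp only:)
    also have "\<dots> = real m * - ln 2 + real m * (- \<epsilon> / 2 * ln 2)"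
      by (simp add: algebra_simps)
    finally have "- (1 - \<delta>) * ((1 + \<epsilon>) * ln (2 ^ m)) = real m * - ln 2 + real m * (- \<epsilon> / 2 * ln 2)" .
    then have "exp (- (1 - \<delta>) * ((1 + \<epsilon>) * ln (2 ^ m))) = exp (real m * - ln 2) * exp (real m * (- \<epsilon> / 2 * ln 2))"
      by (simp only: exp_add)
    also have "\<dots> = (1 / 2) ^ m * (2 powr (- \<epsilon> / 2)) ^ m"
      by (simp only: exp_of_nat_mult powr_def) (simp add: exp_minus inverse_eq_divide)
    finally have eq: "exp (- (1 - \<delta>) * ((1 + \<epsilon>) * ln (2 ^ m))) = (1 / 2) ^ m * (2 powr (- \<epsilon> / 2)) ^ m" .
    have "0 \<le> (1 + \<epsilon>) * ln (2 ^ m :: real)" using \<epsilon> by (intro mult_nonneg_nonneg) auto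
    from path_prob_rate_exceeds_somewhere[OF d \<delta> this \<alpha>, of "2 ^ Suc m"]
    have "path_prob (2 ^ Suc m) (?E m) \<le> real (2 ^ Suc m) * (2 * real CARD('d)) *
      (exp (- (1 - \<delta>) * ((1 + \<epsilon>) * ln (2 ^ m))) / (\<alpha> * (1 - (2 * \<alpha>) powr \<delta>)\<^sup>2))" .
    also have "\<dots> = C * (2 powr (- \<epsilon> / 2)) ^ m"
      unfolding eq by (simp add: C_def power_one_over)
    finally show ?thesis .
  qed
  moreover have "summable (\<lambda>m. C * (2 powr (- \<epsilon> / 2)) ^ m)"
    using \<epsilon> powr_less_cancel_iff[of 2 "- \<epsilon> / 2" 0] by (intro summable_mult summable_geometric) simp
  ultimately show ?thesis
    by (intro summable_comparison_test[OF _ \<open>summable (\<lambda>m. C * _ m)\<close>]) (auto simp: path_prob_nonneg)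
qed

section \<open>Transfer to the random walk\<close>

definition steps_upto :: "(nat \<Rightarrow> 'a \<Rightarrow> int ^ 'd) \<Rightarrow> nat \<Rightarrow> 'a \<Rightarrow> (int ^ 'd) list" where
  "steps_upto X n \<omega> = map (\<lambda>k. X k \<omega>) [1..<Suc n]"

lemma length_steps_upto [simp]: "length (steps_upto X n \<omega>) = n"
  by (simp add: steps_upto_def)

lemma steps_upto_Suc: "steps_upto X (Suc n) \<omega> = steps_upto X n \<omega> @ [X (Suc n) \<omega>]"
  by (simp add: steps_upto_def)

lemma take_steps_upto: "m \<le> n \<Longrightarrow> take m (steps_upto X n \<omega>) = steps_upto X m \<omega>"
  by (simp add: steps_upto_def take_map take_upt del: upt_Suc)

lemma walk_eq_sum_list: "walk X n \<omega> = sum_list (steps_upto X n \<omega>)"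
  by (induction n) (simp_all add: walk_def steps_upto_def)

lemma local_time_eq_visits: "local_time X \<omega> z n = visits z (steps_upto X n \<omega>)"
proof (induction n)
  case 0
  have "{k::nat. 0 < k \<and> k \<le> 0 \<and> walk X k \<omega> = z} = {}" by auto
  then show ?case by (simp only: local_time_def) (simp add: steps_upto_def)
next
  case (Suc n)
  have "{k. 0 < k \<and> k \<le> Suc n \<and> walk X k \<omega> = z} =
      {k. 0 < k \<and> k \<le> n \<and> walk X k \<omega> = z} \<union> (if walk X (Suc n) \<omega> = z then {Suc n} else {})"
    by (auto simp: le_Suc_eq)
  then have "local_time X \<omega> z (Suc n) = local_time X \<omega> z n + of_bool (walk X (Suc n) \<omega> = z)"
    by (auto simp: local_time_def)
  then show ?case
    using Suc by (auto simp: steps_upto_Suc visits_append walk_eq_sum_list algebra_simps)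
qed

context simple_random_walk
begin

lemma random_variable_step: "1 \<le> k \<Longrightarrow> random_variable (count_space UNIV) (X k)"
  using indep_steps by (auto simp: indep_vars_def)

lemma events_steps_upto_eq: "{\<omega> \<in> space M. steps_upto X n \<omega> = xs} \<in> events"
proof (induction n arbitrary: xs)
  case 0
  then show ?case by (simp add: steps_upto_def)
next
  case (Suc n)
  have "{\<omega> \<in> space M. steps_upto X (Suc n) \<omega> = xs} = (if xs = [] then {} else
      {\<omega> \<in> space M. steps_upto X n \<omega> = butlast xs} \<inter> (X (Suc n) -` {last xs} \<inter> space M))"
    by (auto simp: steps_upto_Suc)
  then show ?case
    using Suc measurable_sets[OF random_variable_step[of "Suc n"], of "{last xs}"] by simp
qed

text \<open>Step lists form a countable type, so the events for single lists suffice for arbitrary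
  \<open>P\<close>.\<close>

lemma events_steps_upto: "{\<omega> \<in> space M. P (steps_upto X n \<omega>)} \<in> events"
proof -
  have "steps_upto X n \<in> measurable M (count_space UNIV)"
    using events_steps_upto_eq
    by (auto simp: measurable_count_space_eq2_countable vimage_def Int_def conj_commute)
  from measurable_sets[OF this, of "Collect P"] show ?thesis
    by (simp add: vimage_def Int_def conj_commute)
qed

lemma prob_steps_upto_eq:
  assumes "set xs \<subseteq> unit_steps" "length xs = n"
  shows "prob {\<omega> \<in> space M. steps_upto X n \<omega> = xs} = 1 / (2 * real CARD('d)) ^ n"
proof (cases "n = 0")
  case True
  then show ?thesis using assms prob_space by (simp add: steps_upto_def)
next
  case False
  have "steps_upto X n \<omega> = xs \<longleftrightarrow> (\<forall>k\<in>{1..n}. X k \<omega> = xs ! (k - 1))" for \<omega>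
  proof -
    have "steps_upto X n \<omega> = xs \<longleftrightarrow> (\<forall>i<n. X (Suc i) \<omega> = xs ! i)"
      using assms(2) by (simp add: steps_upto_def list_eq_iff_nth_eq del: upt_Suc)
    also have "\<dots> \<longleftrightarrow> (\<forall>k\<in>Suc ` {..<n}. X k \<omega> = xs ! (k - 1))" by auto
    also have "Suc ` {..<n} = {1..n}" by (simp add: image_Suc_lessThan)
    finally show ?thesis .
  qed
  then have "{\<omega> \<in> space M. steps_upto X n \<omega> = xs} = (\<Inter>k\<in>{1..n}. X k -` {xs ! (k - 1)} \<inter> space M)"
    using False by auto
  also have "prob \<dots> = (\<Prod>k\<in>{1..n}. prob (X k -` {xs ! (k - 1)} \<inter> space M))"
    using False by (intro indep_varsD[OF indep_steps]) auto
  also have "\<dots> = (\<Prod>k\<in>{1..n}. 1 / (2 * real CARD('d)))"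
  proof (rule prod.cong[OF refl])
    fix k assume k: "k \<in> {1..n}"
    then have "xs ! (k - 1) \<in> unit_steps" using assms nth_mem[of "k - 1" xs] by auto
    from step_prob[OF _ this, of k] k
    show "prob (X k -` {xs ! (k - 1)} \<inter> space M) = 1 / (2 * real CARD('d))"
      by (simp add: vimage_def Int_def conj_commute)
  qed
  finally show ?thesis by (simp add: power_one_over)
qed

text \<open>Summing over lists of unit steps gives only a lower bound. Applied to \<open>P\<close>
  and to its negation, whose probabilities add up to 1 on both sides, it gives equality.\<close>

lemma prob_steps_upto: "prob {\<omega> \<in> space M. P (steps_upto X n \<omega>)} = path_prob n P"
proof -
  have ge: "path_prob n P \<le> prob {\<omega> \<in> space M. P (steps_upto X n \<omega>)}" for P
  proof -
    let ?S = "{xs. set xs \<subseteq> unit_steps \<and> length xs = n \<and> P xs}"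
    let ?A = "\<lambda>xs. {\<omega> \<in> space M. steps_upto X n \<omega> = xs}"
    have fin: "finite ?S"
      by (rule finite_subset[OF _ finite_lists_length_eq[OF finite_unit_steps, of n]]) auto
    have "path_prob n P = (\<Sum>xs\<in>?S. prob (?A xs))"
      by (simp add: path_prob_eq_card prob_steps_upto_eq)
    also have "\<dots> = prob (\<Union>xs\<in>?S. ?A xs)"
      using fin events_steps_upto_eq
      by (intro finite_measure_finite_Union[symmetric]) (auto simp: disjoint_family_on_def)
    also have "\<dots> \<le> prob {\<omega> \<in> space M. P (steps_upto X n \<omega>)}"
      by (intro finite_measure_mono events_steps_upto) auto
    finally show ?thesis .
  qed
  show ?thesis
    using ge[of P] ge[of "\<lambda>xs. \<not> P xs"] prob_neg[OF events_steps_upto, of P n]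
    by (simp add: path_prob_not)
qed

lemma AE_eventually_not_path:
  assumes "summable (\<lambda>m. path_prob (N m) (P m))"
  shows "AE \<omega> in M. eventually (\<lambda>m. \<not> P m (steps_upto X (N m) \<omega>)) sequentially"
proof -
  let ?A = "\<lambda>m. {\<omega> \<in> space M. P m (steps_upto X (N m) \<omega>)}"
  have "AE \<omega> in M. eventually (\<lambda>m. \<omega> \<in> space M - ?A m) sequentially"
    using assms events_steps_upto
    by (intro borel_cantelli_AE1) (auto simp: prob_steps_upto emeasure_eq_measure)
  then show ?thesis by eventually_elim (auto elim: eventually_mono)
qed

text \<open>Escape is the decreasing limit of the events of no return within n steps.\<close>

lemma escape_prob_eq: "escape_prob M X = 1 - return_lim TYPE('d)"
proof -
  let ?A = "\<lambda>n. {\<omega> \<in> space M. visits (0 :: int ^ 'd) (steps_upto X n \<omega>) = 0}"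
  have iff: "visits (0 :: int ^ 'd) (steps_upto X n \<omega>) = 0 \<longleftrightarrow> (\<forall>k. 0 < k \<and> k \<le> n \<longrightarrow> walk X k \<omega> \<noteq> 0)" for n \<omega>
  proof -
    have "finite {k. 0 < k \<and> k \<le> n \<and> walk X k \<omega> = 0}" by (rule finite_subset[of _ "{..n}"]) auto
    then show ?thesis by (auto simp: local_time_eq_visits[symmetric] local_time_def)
  qed
  have "range ?A \<subseteq> events"
    using events_steps_upto[of "\<lambda>xs. visits (0 :: int ^ 'd) xs = 0"] by blast
  moreover have "decseq ?A" unfolding decseq_def iff by auto
  ultimately have lim: "(\<lambda>n. prob (?A n)) \<longlonglongrightarrow> prob (\<Inter>n. ?A n)"
    by (rule finite_Lim_measure_decseq)
  have "{\<omega> \<in> space M. \<forall>n\<ge>1. walk X n \<omega> \<noteq> 0} = (\<Inter>n. ?A n)"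
    unfolding iff by (auto simp: Suc_le_eq)
  then have "escape_prob M X = prob (\<Inter>n. ?A n)" by (simp only: escape_prob_def)
  moreover have "prob (?A n) = 1 - reach n (0 :: int ^ 'd)" for n
    using path_prob_not[of n "\<lambda>xs. visits (0 :: int ^ 'd) xs \<noteq> 0"]
      prob_steps_upto[of "\<lambda>xs. visits (0 :: int ^ 'd) xs = 0" n]
    by (simp add: reach_def)
  moreover have "(\<lambda>n. 1 - reach n (0 :: int ^ 'd)) \<longlonglongrightarrow> 1 - return_lim TYPE('d)"
    by (intro tendsto_intros reach_tendsto_return_lim)
  ultimately show ?thesis using lim LIMSEQ_unique by simp
qed

lemma walk_alpha_eq: "walk_alpha M X = pair_alpha TYPE('d)"
  by (simp add: walk_alpha_def pair_alpha_def escape_prob_eq)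

end

section \<open>From powers of two to all times\<close>

lemma pow2_interval:
  assumes "2 ^ m0 \<le> (n::nat)"
  obtains m where "m0 \<le> m" "2 ^ m \<le> n" "n \<le> 2 ^ Suc m"
proof -
  have "1 \<le> n" using assms one_le_power[of "2::nat" m0] by linarith
  then obtain m where m: "2 ^ m \<le> n" "n < 2 ^ (m + 1)" using ex_power_ivl1[of 2 n] by auto
  then have "(2::nat) ^ m0 < 2 ^ (m + 1)" using assms by linarith
  then have "m0 \<le> m" by (simp add: power_strict_increasing_iff del: power_Suc)
  with m that show ?thesis by auto
qed

text \<open>For \<epsilon> >= 1 the scaling factor is not positive, so the only point with
  nonnegative coordinates is (0, 0), whose rate is 0. This allows passing to a parameter below
  1.\<close>

lemma scaled_region_B_imp_rate_le:
  assumes "(real k, real l) \<in> (\<lambda>p. ((1 - \<epsilon>) * ln (real n)) *\<^sub>R p) ` region_B \<alpha>"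
    and "\<epsilon>' \<le> \<epsilon>" "\<epsilon>' \<le> 1" "2 \<le> n"
  shows "pair_rate \<alpha> (real k) (real l) \<le> (1 - \<epsilon>') * ln (real n)"
proof (cases "\<epsilon> < 1")
  case True
  then have "0 < (1 - \<epsilon>) * ln (real n)" using assms(4) by simp
  then have "pair_rate \<alpha> (real k) (real l) \<le> (1 - \<epsilon>) * ln (real n)"
    using assms(1) scaled_region_B_iff[of "(1 - \<epsilon>) * ln (real n)" "real k" "real l" \<alpha>] by simp
  also have "\<dots> \<le> (1 - \<epsilon>') * ln (real n)" using assms(2,4) by (intro mult_right_mono) auto
  finally show ?thesis .
next
  case False
  then have "(1 - \<epsilon>) * ln (real n) \<le> 0" using assms(4) by (intro mult_nonpos_nonneg) auto
  moreover obtain x y where "0 \<le> x" "0 \<le> y"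
    "real k = (1 - \<epsilon>) * ln (real n) * x" "real l = (1 - \<epsilon>) * ln (real n) * y"
    using assms(1) by (auto simp: region_B_def)
  ultimately have "real k \<le> 0" "real l \<le> 0" using mult_nonpos_nonneg by metis+
  then show ?thesis using assms(3,4) by simp
qed

theorem theorem1p1:
  fixes M :: "'a measure" and X :: "nat \<Rightarrow> 'a \<Rightarrow> int ^ 'd" and \<epsilon> :: real
  assumes "CARD('d) \<ge> 4"
    and "simple_random_walk M X"
    and "\<epsilon> > 0"
  shows "AE \<omega> in M. \<exists>n0::nat. \<forall>n\<ge>n0.
    (\<forall>z. \<forall>e\<in>unit_steps.
       (real (local_time X \<omega> z n), real (local_time X \<omega> (z + e) n))
         \<in> (\<lambda>p. ((1 + \<epsilon>) * ln (real n)) *\<^sub>R p) ` region_B (walk_alpha M X)) \<and>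
    (\<forall>k l :: nat.
       (real k, real l) \<in> (\<lambda>p. ((1 - \<epsilon>) * ln (real n)) *\<^sub>R p) ` region_B (walk_alpha M X) \<longrightarrow>
       (\<forall>e\<in>unit_steps.
          (\<exists>z1. (local_time X \<omega> z1 n, local_time X \<omega> (z1 + e) n) = (k + 1, l)) \<and>
          (\<exists>z2. (local_time X \<omega> z2 n, local_time X \<omega> (z2 + e) n) = (k, l + 1))))"
proof -
  interpret simple_random_walk M X by fact
  let ?\<alpha> = "walk_alpha M X"
  \<comment> \<open>The summability behind part (ii) requires a parameter below 1.\<close>
  define \<epsilon>' where "\<epsilon>' = min \<epsilon> (1 / 2)"
  have \<epsilon>': "0 < \<epsilon>'" "\<epsilon>' < 1" "\<epsilon>' \<le> \<epsilon>" using assms(3) by (auto simp: \<epsilon>'_def)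
  note upper = AE_eventually_not_path[OF
      summable_path_prob_rate_exceeds[OF assms(1) walk_alpha_eq assms(3)]]
  note lower = AE_eventually_not_path[OF
      summable_path_prob_pair_unseen[OF assms(1) walk_alpha_eq \<epsilon>'(1,2)]]
  show ?thesis
    using upper lower
  proof eventually_elim
    case (elim \<omega>)
    let ?xs = "\<lambda>n. steps_upto X n \<omega>"
    obtain m0 where m0:
      "\<And>m n z e. m0 \<le> m \<Longrightarrow> n \<le> 2 ^ Suc m \<Longrightarrow> e \<in> unit_steps \<Longrightarrow>
        pair_rate ?\<alpha> (real (visits z (take n (?xs (2 ^ Suc m))))) (real (visits (z + e) (take n (?xs (2 ^ Suc m)))))
        \<le> (1 + \<epsilon>) * ln (2 ^ m)"
      "\<And>m e k l. m0 \<le> m \<Longrightarrow> e \<in> unit_steps \<Longrightarrow> pair_rate ?\<alpha> (real k) (real l) \<le> (1 - \<epsilon>') * ln (2 ^ Suc m) \<Longrightarrow>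
        pair_seen (2 ^ m) (2 ^ Suc m) e k l (?xs (2 ^ Suc m))"
      using eventually_conj[OF elim] unfolding eventually_sequentially not_ex not_less by (metis not_le)
    \<comment> \<open>The bound 2 makes ln n positive, as the rescaling of \<open>region_B\<close>
      requires.\<close>
    show ?case
    proof (intro exI[of _ "max 2 (2 ^ m0) :: nat"] allI impI conjI ballI)
      fix n :: nat and z e assume n: "max 2 (2 ^ m0) \<le> n" and e: "e \<in> (unit_steps :: (int ^ 'd) set)"
      from n obtain m where m: "m0 \<le> m" "2 ^ m \<le> n" "n \<le> 2 ^ Suc m"
        using pow2_interval[of m0 n] by auto
      have "pair_rate ?\<alpha> (real (local_time X \<omega> z n)) (real (local_time X \<omega> (z + e) n)) \<le> (1 + \<epsilon>) * ln (2 ^ m)"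
        using m0(1)[OF m(1,3) e, of z] m(3) by (simp add: local_time_eq_visits take_steps_upto)
      also have "\<dots> \<le> (1 + \<epsilon>) * ln (real n)"
      proof (intro mult_left_mono)
        have "(2::real) ^ m \<le> real n" using m(2) by (simp flip: of_nat_le_iff)
        then show "ln (2 ^ m) \<le> ln (real n)" using n by (intro ln_mono) auto
      qed (use assms(3) in auto)
      finally show "(real (local_time X \<omega> z n), real (local_time X \<omega> (z + e) n))
         \<in> (\<lambda>p. ((1 + \<epsilon>) * ln (real n)) *\<^sub>R p) ` region_B ?\<alpha>"
        using n assms(3) by (subst scaled_region_B_iff) auto
    next
      fix n k l :: nat and e :: "int ^ 'd"
      assume n: "max 2 (2 ^ m0) \<le> n" and e: "e \<in> unit_steps"
        and kl: "(real k, real l) \<in> (\<lambda>p. ((1 - \<epsilon>) * ln (real n)) *\<^sub>R p) ` region_B ?\<alpha>"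
      from n obtain m where m: "m0 \<le> m" "2 ^ m \<le> n" "n \<le> 2 ^ Suc m"
        using pow2_interval[of m0 n] by auto
      have "pair_rate ?\<alpha> (real k) (real l) \<le> (1 - \<epsilon>') * ln (real n)"
        using scaled_region_B_imp_rate_le[OF kl \<epsilon>'(3)] \<epsilon>' n by simp
      also have "\<dots> \<le> (1 - \<epsilon>') * ln (2 ^ Suc m)"
      proof (intro mult_left_mono)
        have "real n \<le> (2::real) ^ Suc m" using m(3) by (metis of_nat_le_iff of_nat_numeral of_nat_power)
        then show "ln (real n) \<le> ln (2 ^ Suc m)" using n by (intro ln_mono) auto
      qed (use \<epsilon>' in auto)
      finally have rate: "pair_rate ?\<alpha> (real k) (real l) \<le> (1 - \<epsilon>') * ln (2 ^ Suc m)" .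
      have seen: "\<exists>z. local_time X \<omega> z n = Suc k' \<and> local_time X \<omega> (z + e') n = l'"
        if "e' \<in> unit_steps" "pair_rate ?\<alpha> (real k') (real l') \<le> (1 - \<epsilon>') * ln (2 ^ Suc m)" for k' l' e'
        using m0(2)[OF m(1) that] m by (auto simp: pair_seen_def local_time_eq_visits take_steps_upto)
      show "\<exists>z1. (local_time X \<omega> z1 n, local_time X \<omega> (z1 + e) n) = (k + 1, l)"
        using seen[OF e rate] by simp
      \<comment> \<open>The second pair comes from the first kind with the counts exchanged and the
        direction reversed, viewed from the other end \<open>z + - e\<close>.\<close>
      have "- e \<in> unit_steps" using e by simp
      from seen[OF this rate[unfolded pair_rate_commute[of _ "real k"]]]
      obtain z where "local_time X \<omega> z n = Suc l" "local_time X \<omega> (z + - e) n = k" by blast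
      then show "\<exists>z2. (local_time X \<omega> z2 n, local_time X \<omega> (z2 + e) n) = (k, l + 1)"
        by (intro exI[of _ "z + - e"]) simp
    qed
  qed
qed

end
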